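(* Let $\mathcal{P}\subset\mathbb{R}^2$ be a bounded convex $d$-gon (a bounded convex polygon with exactly $d$ sides) with $d\ge4$. Then the extreme points of $\mathcal{P}$ are not crucial free extreme points of $\mathcal{W}^{\max}(\mathcal{P})$.
   Context: All matrices are real. $SM_n(\mathbb{R})^g$ is the set of $g$-tuples of real symmetric $n\times n$ matrices, $SM(\mathbb{R})^g=\bigcup_{n\ge1}SM_n(\mathbb{R})^g$, and for $K\subseteq SM(\mathbb{R})^g$, $K(n)=K\cap SM_n(\mathbb{R})^g$. For a matrix $V$, $V^TXV=(V^TX_1V,\dots,V^TX_gV)$. $X\sim_u Y$ (unitarily equivalent) means $U^TXU=Y$ for some real orthogonal matrix $U$. Direct sums of tuples are coordinatewise. Points of $\mathbb{R}^g$ are identified with tuples in $SM_1(\mathbb{R})^g$. A matrix convex combination of elements of $K$ is a finite sum $\sum_{\ell=1}^m V_\ell^TX^\ell V_\ell$ with $X^\ell\in K(n_\ell)$, $V_\ell\in M_{n_\ell\times n}(\mathbb{R})$, $\sum_\ell V_\ell^TV_\ell=I_n$. The matrix convex hull $\mathrm{co}^{\mathrm{mat}}(K)$ is the set of all matrix convex combinations of elements of $K$; $K$ is matrix convex if $K=\mathrm{co}^{\mathrm{mat}}(K)$. Closures of subsets of $SM(\mathbb{R})^g$ are taken levelwise. For a closed convex set $C\subseteq\mathbb{R}^g$, the maximal matrix convex set $\mathcal{W}^{\max}(C)$ over $C$ is the set of all $X\in SM(\mathbb{R})^g$ satisfying every affine inequality satisfied by $C$: if $a_0+\sum_ka_kx_k\ge0$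 for all $x\in C$, then $a_0I+\sum_ka_kX_k\succeq0$. A point $X\in K(n)$ of a matrix convex set $K$ is a free extreme point of $K$ if whenever $X=\sum_{\ell=1}^m V_\ell^TY^\ell V_\ell$ is a matrix convex combination of $Y^\ell\in K(n_\ell)$ with every $V_\ell\ne0$, then for each $\ell$ either $n_\ell=n$ and $X\sim_uY^\ell$, or $n_\ell>n$ and there is $Z^\ell\in K$ with $X\oplus Z^\ell\sim_uY^\ell$. Write $\partial^{\mathrm{free}}K$ for the set of free extreme points. $X\in\partial^{\mathrm{free}}K$ is a crucial free extreme point of $K$ if $X\notin\overline{\mathrm{co}^{\mathrm{mat}}(\partial^{\mathrm{free}}K\setminus\{Y\in K:Y\sim_uX\})}$. *)

theory Defs
  imports "HOL-Analysis.Polytope" "Jordan_Normal_Form.Matrix"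
begin

text \<open>
  A \<open>g\<close>-tuple of real matrices is a function \<open>'g \<Rightarrow> real mat\<close> on a finite index type \<open>'g\<close>.
  The size of the matrices is carried by \<^const>\<open>carrier_mat\<close>, so one set can hold tuples of
  every size. The library type of matrices has \<open>0 \<times> 0\<close> matrices; sizes are required to be
  at least 1 wherever they could otherwise enter.
\<close>

type_synonym 'g mat_tuple = "'g \<Rightarrow> real mat"

definition SM :: "nat \<Rightarrow> ('g::finite) mat_tuple set" where
  "SM n = {X. \<forall>k. X k \<in> carrier_mat n n \<and> transpose_mat (X k) = X k}"

definition level :: "('g::finite) mat_tuple set \<Rightarrow> nat \<Rightarrow> 'g mat_tuple set" where
  "level K n = K \<inter> SM n"

text \<open>The type of matrices is no additive monoid, so sums of \<open>n \<times> n\<close> matrices are taken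
  entrywise.\<close>

definition msum :: "nat \<Rightarrow> 'i set \<Rightarrow> ('i \<Rightarrow> real mat) \<Rightarrow> real mat" where
  "msum n I A = mat n n (\<lambda>(r, c). \<Sum>i\<in>I. A i $$ (r, c))"

definition psd :: "nat \<Rightarrow> real mat \<Rightarrow> bool" where
  "psd n A \<longleftrightarrow> A \<in> carrier_mat n n \<and> transpose_mat A = A \<and>
     (\<forall>v\<in>carrier_vec n. 0 \<le> scalar_prod v (A *\<^sub>v v))"

definition conj_tuple :: "real mat \<Rightarrow> ('g::finite) mat_tuple \<Rightarrow> 'g mat_tuple" where
  "conj_tuple V X = (\<lambda>k. transpose_mat V * X k * V)"

definition unitarily_equiv :: "('g::finite) mat_tuple \<Rightarrow> 'g mat_tuple \<Rightarrow> bool" where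
  "unitarily_equiv X Y \<longleftrightarrow>
     (\<exists>n U. (\<forall>k. X k \<in> carrier_mat n n \<and> Y k \<in> carrier_mat n n) \<and>
        U \<in> carrier_mat n n \<and> transpose_mat U * U = 1\<^sub>m n \<and> conj_tuple U X = Y)"

definition direct_sum :: "('g::finite) mat_tuple \<Rightarrow> 'g mat_tuple \<Rightarrow> 'g mat_tuple" where
  "direct_sum X Y = (\<lambda>k. diag_block_mat [X k, Y k])"

definition point_tuple :: "real ^ 'g \<Rightarrow> ('g::finite) mat_tuple" where
  "point_tuple x = (\<lambda>k. mat 1 1 (\<lambda>_. vec_nth x k))"

text \<open>\<open>X\<close> is the sum of \<open>V\<^sub>l\<^sup>T Y\<^sub>l V\<^sub>l\<close> over \<open>l < m\<close>, where \<open>Y\<^sub>l\<close> has size \<open>N l\<close>.\<close>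

definition matrix_convex_comb ::
  "('g::finite) mat_tuple set \<Rightarrow> nat \<Rightarrow> 'g mat_tuple \<Rightarrow> nat \<Rightarrow> (nat \<Rightarrow> nat) \<Rightarrow>
     (nat \<Rightarrow> real mat) \<Rightarrow> (nat \<Rightarrow> 'g mat_tuple) \<Rightarrow> bool" where
  "matrix_convex_comb K n X m N V Y \<longleftrightarrow>
     (\<forall>l<m. Y l \<in> level K (N l) \<and> V l \<in> carrier_mat (N l) n) \<and>
     msum n {..<m} (\<lambda>l. transpose_mat (V l) * V l) = 1\<^sub>m n \<and>
     X = (\<lambda>k. msum n {..<m} (\<lambda>l. conj_tuple (V l) (Y l) k))"

definition co_mat :: "('g::finite) mat_tuple set \<Rightarrow> 'g mat_tuple set" where
  "co_mat K = {X. \<exists>n\<ge>1. \<exists>m N V Y. matrix_convex_comb K n X m N V Y}"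

text \<open>Each level is a finite-dimensional space, so its topology is that of entrywise
  convergence, and closures can be described by sequences.\<close>

definition level_closure :: "('g::finite) mat_tuple set \<Rightarrow> 'g mat_tuple set" where
  "level_closure K = {X. \<exists>n\<ge>1. X \<in> SM n \<and>
     (\<exists>Y. (\<forall>j. Y j \<in> level K n) \<and>
        (\<forall>k. \<forall>r<n. \<forall>c<n. (\<lambda>j::nat. Y j k $$ (r, c)) \<longlonglongrightarrow> X k $$ (r, c)))}"

definition Wmax :: "(real ^ 'g) set \<Rightarrow> ('g::finite) mat_tuple set" where
  "Wmax C = {X. \<exists>n\<ge>1. X \<in> SM n \<and>
     (\<forall>a0 a. (\<forall>x\<in>C. 0 \<le> a0 + (\<Sum>k\<in>UNIV. a k * vec_nth x k)) \<longrightarrow>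
        psd n (a0 \<cdot>\<^sub>m 1\<^sub>m n + msum n UNIV (\<lambda>k. a k \<cdot>\<^sub>m X k)))}"

definition free_extreme :: "('g::finite) mat_tuple set \<Rightarrow> 'g mat_tuple set" where
  "free_extreme K = {X. \<exists>n\<ge>1. X \<in> level K n \<and>
     (\<forall>m N V Y. matrix_convex_comb K n X m N V Y \<and> (\<forall>l<m. V l \<noteq> 0\<^sub>m (N l) n) \<longrightarrow>
        (\<forall>l<m. (N l = n \<and> unitarily_equiv X (Y l)) \<or>
               (n < N l \<and> (\<exists>Z\<in>K. unitarily_equiv (direct_sum X Z) (Y l)))))}"

definition crucial_free_extreme :: "('g::finite) mat_tuple set \<Rightarrow> 'g mat_tuple set" where
  "crucial_free_extreme K = {X \<in> free_extreme K.
     X \<notin> level_closure (co_mat (free_extreme K - {Y \<in> K. unitarily_equiv Y X}))}"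

end

theory Submission
  imports Defs "Jordan_Normal_Form.Determinant"
begin

text \<open>
  Let \<open>v\<close> be a vertex of \<open>P\<close>. Since \<open>P\<close> has at least four edges, some vertex \<open>w\<close> is not adjacent to \<open>v\<close>.
  There are ellipses inside \<open>P\<close>, tangent to the two edges at \<open>v\<close> and to the two edges at \<open>w\<close>, that
  degenerate to the segment from \<open>v\<close> to \<open>w\<close>. An ellipse with centre \<open>c\<close> and conjugate radii \<open>p\<close>, \<open>q\<close> is
  the numerical range of the pair of matrices with rows \<open>(c + p, q)\<close> and \<open>(q, c - p)\<close>. Tangency to four
  edges makes this pair a free extreme point, of size 2 and so not equivalent to \<open>v\<close>. Its compression
  \<open>c - p\<close> is a point of the ellipse, and these points converge to \<open>v\<close>.
\<close>

section \<open>Vertices and edges of a polygon\<close>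

text \<open>Four edges are what the linear algebra asks for. When an ellipse pair \<open>X\<close>
  is a matrix convex combination, a row of \<open>Y V - V X\<close>, taken over both coordinates,
  has four real unknowns. An edge tangent to the ellipse supplies one linear equation for them, so
  four different tangents can force them to vanish and three cannot. On the other side, an ellipse
  has five parameters, so four tangencies leave one free, enough to shrink the ellipse onto a
  segment.

  That segment has to be a diagonal of \<open>P\<close>: then the two edges at \<open>v\<close> and
  the two at \<open>w\<close> are four different ones, and every other edge keeps a positive
  distance from the segment, so thin ellipses do not cross it. A triangle has no diagonal.

  A nondegenerate ellipse inside \<open>P\<close> cannot pass through a corner, so \<open>v\<close>
  is reached only in the limit; this is where the closure in the definition of crucial points
  enters.\<close>

lemma inner_plane: "inner x y = vec_nth x 1 * vec_nth y 1 + vec_nth x 2 * vec_nth y 2"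
  for x y :: "real ^ 2"
  by (simp add: inner_vec_def UNIV_2)

text \<open>\<open>D\<close> is the determinant of \<open>z\<close> and \<open>d\<close>. Both are
  orthogonal to \<open>a\<close>, so \<open>a1 * D = a2 * D = 0\<close> and \<open>D\<close>
  vanishes; then \<open>c\<close>, the coefficient of the orthogonal projection of \<open>z\<close>
  to the line of \<open>d\<close>, reproduces \<open>z\<close> exactly.\<close>

lemma orthogonal_in_plane_parallel:
  fixes a d z :: "real ^ 2"
  assumes "a \<noteq> 0" "d \<noteq> 0" "inner a d = 0" "inner a z = 0"
  obtains c where "z = c *\<^sub>R d"
proof -
  define a1 a2 d1 d2 z1 z2 where coords: "a1 = vec_nth a 1" "a2 = vec_nth a 2" "d1 = vec_nth d 1"
    "d2 = vec_nth d 2" "z1 = vec_nth z 1" "z2 = vec_nth z 2"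
  define D where "D = z1 * d2 - z2 * d1"
  have eqs: "a1 * d1 + a2 * d2 = 0" "a1 * z1 + a2 * z2 = 0"
    using assms(3,4) by (simp_all add: inner_plane coords)
  have "a1 * D = d2 * (a1 * z1 + a2 * z2) - z2 * (a1 * d1 + a2 * d2)"
    "a2 * D = z1 * (a1 * d1 + a2 * d2) - d1 * (a1 * z1 + a2 * z2)"
    by (simp_all add: D_def algebra_simps)
  moreover have "a1 \<noteq> 0 \<or> a2 \<noteq> 0"
    using assms(1) by (auto simp: Finite_Cartesian_Product.vec_eq_iff forall_2 coords)
  ultimately have D: "D = 0" unfolding eqs by auto
  have d: "d1 * d1 + d2 * d2 \<noteq> 0"
    using assms(2) by (auto simp: sum_squares_eq_zero_iff Finite_Cartesian_Product.vec_eq_iff forall_2 coords)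
  define c where "c = (z1 * d1 + z2 * d2) / (d1 * d1 + d2 * d2)"
  have "(d1 * d1 + d2 * d2) * z1 = (z1 * d1 + z2 * d2) * d1 + d2 * D"
    "(d1 * d1 + d2 * d2) * z2 = (z1 * d1 + z2 * d2) * d2 - d1 * D"
    by (simp_all add: D_def algebra_simps)
  then have "z1 = c * d1" "z2 = c * d2"
    using d D by (simp_all add: c_def field_simps)
  then have "z = c *\<^sub>R d" by (simp add: Finite_Cartesian_Product.vec_eq_iff forall_2 coords)
  then show ?thesis by (rule that)
qed

text \<open>A minimal description of a polygon by half-planes. Minimality appears in the two forms
  in which it is used: every index cuts out an edge, and no half-plane is listed twice under a
  positive rescaling.\<close>

locale polygon_halfplanes =
  fixes P :: "(real ^ 2) set" and F :: "'h set" and a :: "'h \<Rightarrow> real ^ 2" and b :: "'h \<Rightarrow> real"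
  assumes polytope: "polytope P" and dim: "aff_dim P = 2"
    and finite_F: "finite F"
    and P_eq: "P = {x. \<forall>h\<in>F. inner (a h) x \<le> b h}"
    and normal_nonzero: "h \<in> F \<Longrightarrow> a h \<noteq> 0"
    and edge_iff: "E edge_of P \<longleftrightarrow> (\<exists>h\<in>F. E = P \<inter> {x. inner (a h) x = b h})"
    and halfplane_inj: "\<lbrakk>h \<in> F; h' \<in> F; c > 0; a h' = c *\<^sub>R a h; b h' = c * b h\<rbrakk> \<Longrightarrow> h' = h"
begin

lemma edge_direction:
  assumes "h \<in> F" "v \<in> P" "inner (a h) v = b h"
  obtains d where "d \<noteq> 0" "v + d \<in> P" "inner (a h) d = 0"
proof -
  let ?E = "P \<inter> {x. inner (a h) x = b h}"
  have "aff_dim ?E = 1" using edge_iff[of ?E] assms(1) by (auto simp: edge_of_def)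
  then have "?E \<noteq> {v}" by auto
  then obtain x where "x \<in> ?E" "x \<noteq> v" using assms by blast
  with that[of "x - v"] show ?thesis using assms by (auto simp: inner_diff_right)
qed

text \<open>Equality would make both normals orthogonal to \<open>d\<close>, hence proportional. A
  positive factor gives the same half-plane twice; a negative one gives opposite half-planes, which
  confine \<open>P\<close> to a line.\<close>

lemma edge_direction_strict:
  assumes h: "h \<in> F" "inner (a h) v = b h" and h': "h' \<in> F" "inner (a h') v = b h'"
    and "h' \<noteq> h" and d: "d \<noteq> 0" "v + d \<in> P" "inner (a h) d = 0"
  shows "inner (a h') d < 0"
proof (rule ccontr)
  assume "\<not> ?thesis"
  moreover have "inner (a h') d \<le> 0"
    using d(2) h' unfolding P_eq by (auto simp: inner_add_right)
  ultimately have "inner d (a h') = 0" by (simp add: inner_commute)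
  moreover have "inner d (a h) = 0" using d by (simp add: inner_commute)
  ultimately obtain c where c: "a h' = c *\<^sub>R a h"
    using orthogonal_in_plane_parallel[of d "a h"] d normal_nonzero[OF h(1)] by metis
  have b: "b h' = c * b h" using h h' c by (metis inner_scaleR_left)
  have "c \<noteq> 0" using c normal_nonzero[OF h'(1)] by auto
  moreover have "\<not> c > 0" using halfplane_inj[OF h(1) h'(1) _ c b] assms(5) by blast
  ultimately have "c < 0" by simp
  have "P \<subseteq> {x. inner (a h) x = b h}"
  proof
    fix x assume x: "x \<in> P"
    have "inner (a h) x \<le> b h" "inner (a h') x \<le> b h'" using x h h' unfolding P_eq by auto
    with \<open>c < 0\<close> show "x \<in> {x. inner (a h) x = b h}"
      unfolding c b by (simp add: mult_le_cancel_left)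
  qed
  then have "aff_dim P \<le> aff_dim {x. inner (a h) x = b h}" by (rule aff_dim_subset)
  then show False using dim normal_nonzero[OF h(1)] by (simp add: aff_dim_hyperplane)
qed

text \<open>With three edges at \<open>v\<close>, each edge direction is strictly negative on the
  normals of the other two. This makes \<open>d3\<close> a positive combination of \<open>d1\<close>
  and \<open>d2\<close>, on both of which the third normal is negative, although it vanishes on
  \<open>d3\<close>.\<close>

lemma at_most_two_edges_at_point:
  assumes v: "v \<in> P" and h: "h1 \<in> F" "h2 \<in> F" "h3 \<in> F"
    and act: "inner (a h1) v = b h1" "inner (a h2) v = b h2" "inner (a h3) v = b h3"
    and ne: "h1 \<noteq> h2"
  shows "h3 = h1 \<or> h3 = h2"
proof (rule ccontr)
  assume n: "\<not> ?thesis"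
  obtain d1 where d1: "d1 \<noteq> 0" "v + d1 \<in> P" "inner (a h1) d1 = 0"
    using edge_direction[OF h(1) v act(1)] .
  obtain d2 where d2: "d2 \<noteq> 0" "v + d2 \<in> P" "inner (a h2) d2 = 0"
    using edge_direction[OF h(2) v act(2)] .
  obtain d3 where d3: "d3 \<noteq> 0" "v + d3 \<in> P" "inner (a h3) d3 = 0"
    using edge_direction[OF h(3) v act(3)] .
  note S = edge_direction_strict
  have s: "inner (a h1) d2 < 0" "inner (a h1) d3 < 0" "inner (a h2) d1 < 0" "inner (a h2) d3 < 0"
    "inner (a h3) d1 < 0" "inner (a h3) d2 < 0"
    using S[OF h(2) act(2) h(1) act(1) _ d2] S[OF h(3) act(3) h(1) act(1) _ d3]
      S[OF h(1) act(1) h(2) act(2) _ d1] S[OF h(3) act(3) h(2) act(2) _ d3]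
      S[OF h(1) act(1) h(3) act(3) _ d1] S[OF h(2) act(2) h(3) act(3) _ d2] n ne by auto
  \<comment> \<open>The coefficients are solved from the requirement that \<open>z\<close> be
    orthogonal to \<open>a h1\<close>, which sees only \<open>d2\<close> and \<open>d3\<close>, and
    to \<open>a h2\<close>, which sees only \<open>d1\<close> and \<open>d3\<close>. Both are
    quotients of negative numbers.\<close>
  define y where "y = inner (a h1) d3 / inner (a h1) d2"
  define x where "x = inner (a h2) d3 / inner (a h2) d1"
  define z where "z = d3 - x *\<^sub>R d1 - y *\<^sub>R d2"
  have pos: "x > 0" "y > 0" using s by (auto simp: x_def y_def divide_neg_neg)
  have "inner (a h1) z = 0" "inner (a h2) z = 0"
    using s d1 d2 by (auto simp: z_def x_def y_def inner_diff_right)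
  then obtain c where c: "z = c *\<^sub>R d1"
    using orthogonal_in_plane_parallel normal_nonzero[OF h(1)] d1 by metis
  have "c * inner (a h2) d1 = 0" using \<open>inner (a h2) z = 0\<close> unfolding c by simp
  then have "c = 0" using s by simp
  then have "z = 0" using c by simp
  then have "d3 = x *\<^sub>R d1 + y *\<^sub>R d2" by (simp add: z_def algebra_simps)
  then have "x * inner (a h3) d1 + y * inner (a h3) d2 = 0"
    using d3(3) by (simp add: inner_add_right)
  moreover have "x * inner (a h3) d1 < 0" "y * inner (a h3) d2 < 0"
    using pos s by (auto simp: mult_pos_neg)
  ultimately show False by simp
qed

text \<open>If all active normals annihilated \<open>d\<close>, small steps along \<open>d\<close>
  and \<open>- d\<close> would stay in \<open>P\<close>: active constraints do not change, and the
  finitely many others have slack. Then \<open>v\<close> would be a midpoint of two points of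
  \<open>P\<close>.\<close>

lemma vertex_active_normal:
  assumes v: "v extreme_point_of P" and d: "d \<noteq> 0"
  obtains h where "h \<in> F" "inner (a h) v = b h" "inner (a h) d \<noteq> 0"
proof (rule ccontr)
  assume "\<not> thesis"
  with that have n: "\<And>h. h \<in> F \<Longrightarrow> inner (a h) v = b h \<Longrightarrow> inner (a h) d = 0" by blast
  have vP: "v \<in> P" using v by (simp add: extreme_point_of_def)
  have "\<forall>\<^sub>F e in at_right 0. \<forall>h\<in>F. inner (a h) (v + e *\<^sub>R d) \<le> b h \<and> inner (a h) (v - e *\<^sub>R d) \<le> b h"
  proof (intro eventually_ball_finite finite_F ballI)
    fix h assume h: "h \<in> F"
    show "\<forall>\<^sub>F e in at_right 0. inner (a h) (v + e *\<^sub>R d) \<le> b h \<and> inner (a h) (v - e *\<^sub>R d) \<le> b h"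
    proof (cases "inner (a h) v = b h")
      case True
      then show ?thesis using n[OF h True] by (simp add: inner_add_right inner_diff_right)
    next
      case False
      then have lt: "inner (a h) v < b h" using vP h unfolding P_eq by force
      have "((\<lambda>e. inner (a h) (v + e *\<^sub>R d)) \<longlongrightarrow> inner (a h) (v + 0 *\<^sub>R d)) (at_right 0)"
        "((\<lambda>e. inner (a h) (v - e *\<^sub>R d)) \<longlongrightarrow> inner (a h) (v - 0 *\<^sub>R d)) (at_right 0)"
        by (intro tendsto_intros)+
      from order_tendstoD(2)[OF this(1), of "b h"] order_tendstoD(2)[OF this(2), of "b h"] lt
      have "\<forall>\<^sub>F e in at_right 0. inner (a h) (v + e *\<^sub>R d) < b h"
        "\<forall>\<^sub>F e in at_right 0. inner (a h) (v - e *\<^sub>R d) < b h" by auto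
      then show ?thesis by eventually_elim auto
    qed
  qed
  moreover have "\<forall>\<^sub>F e in at_right 0. e > (0::real)" by (rule eventually_at_right_less)
  ultimately have "\<forall>\<^sub>F e in at_right 0. e > (0::real) \<and> (\<forall>h\<in>F. inner (a h) (v + e *\<^sub>R d) \<le> b h \<and> inner (a h) (v - e *\<^sub>R d) \<le> b h)"
    by eventually_elim simp
  from eventually_happens'[OF _ this] obtain e :: real where e: "e > 0"
    "\<forall>h\<in>F. inner (a h) (v + e *\<^sub>R d) \<le> b h \<and> inner (a h) (v - e *\<^sub>R d) \<le> b h" by auto
  have "v + e *\<^sub>R d \<in> P" "v - e *\<^sub>R d \<in> P" using e unfolding P_eq by auto
  moreover have "v \<in> open_segment (v - e *\<^sub>R d) (v + e *\<^sub>R d)"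
  proof -
    have "inner (v - e *\<^sub>R d) d < inner (v + e *\<^sub>R d) d"
      using e(1) d by (simp add: inner_add_left inner_diff_left)
    then have "v - e *\<^sub>R d \<noteq> v + e *\<^sub>R d" by (metis less_irrefl)
    moreover have "v = midpoint (v - e *\<^sub>R d) (v + e *\<^sub>R d)"
      by (simp add: midpoint_def Finite_Cartesian_Product.vec_eq_iff)
    ultimately show ?thesis by (metis midpoint_in_open_segment)
  qed
  ultimately show False using v unfolding extreme_point_of_def by blast
qed

lemma vertex_two_edges:
  assumes v: "v extreme_point_of P"
  obtains h1 h2 where "h1 \<in> F" "h2 \<in> F" "h1 \<noteq> h2" "inner (a h1) v = b h1" "inner (a h2) v = b h2"
proof -
  have vP: "v \<in> P" using v by (simp add: extreme_point_of_def)
  \<comment> \<open>Any nonzero direction serves here, since it only has to produce a first active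
    edge; the direction of that edge then produces a second one.\<close>
  have "axis 1 1 \<noteq> (0::real^2)" by (simp add: axis_eq_0_iff)
  then obtain h1 where h1: "h1 \<in> F" "inner (a h1) v = b h1"
    using vertex_active_normal[OF v] by metis
  then obtain d where d: "d \<noteq> 0" "inner (a h1) d = 0" using edge_direction[OF h1(1) vP h1(2)] by metis
  then obtain h2 where "h2 \<in> F" "inner (a h2) v = b h2" "inner (a h2) d \<noteq> 0"
    using vertex_active_normal[OF v] by metis
  with h1 d that show ?thesis by metis
qed

lemma three_collinear_not_all_vertices:
  assumes "p extreme_point_of P" "q extreme_point_of P" "r extreme_point_of P"
    and "h \<in> F" "inner (a h) p = b h" "inner (a h) q = b h" "inner (a h) r = b h"
    and "p \<noteq> q" "p \<noteq> r"
  shows "q = r"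
proof (rule ccontr)
  assume "q \<noteq> r"
  have "inner (a h) (q - p) = 0" "inner (a h) (r - p) = 0"
    using assms by (auto simp: inner_diff_right)
  then obtain c where c: "r - p = c *\<^sub>R (q - p)"
    using orthogonal_in_plane_parallel[of "a h" "q - p" "r - p"] normal_nonzero[OF assms(4)] assms(8)
    by auto
  then have r: "r = p + c *\<^sub>R (q - p)" by (simp add: algebra_simps)
  have "r = c *\<^sub>R q + (1 - c) *\<^sub>R p" unfolding r by (simp add: algebra_simps)
  then have "collinear {q, r, p}" unfolding collinear_3_expand by blast
  then have "between (r, p) q \<or> between (p, q) r \<or> between (q, r) p"
    by (rule collinear_between_cases[THEN iffD1])
  then have "q \<in> closed_segment r p \<or> r \<in> closed_segment p q \<or> p \<in> closed_segment q r"
    unfolding between_mem_segment .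
  then have "q \<in> open_segment r p \<or> r \<in> open_segment p q \<or> p \<in> open_segment q r"
    using assms(8,9) \<open>q \<noteq> r\<close> unfolding open_segment_def by blast
  then show False using assms(1-3) unfolding extreme_point_of_def by blast
qed

section \<open>Counting vertices and edges\<close>

lemma finite_vertices: "finite {v. v extreme_point_of P}"
  using polytope finite_polyhedron_extreme_points polytope_imp_polyhedron by blast

lemma card_vertices_on_edge:
  assumes "h \<in> F"
  shows "card ({v. v extreme_point_of P} \<inter> {x. inner (a h) x = b h}) \<le> 2" (is "card ?S \<le> 2")
proof (rule ccontr)
  assume "\<not> ?thesis"
  then have "3 \<le> card ?S" by simp
  then obtain T where "T \<subseteq> ?S" "card T = 3" by (metis obtain_subset_with_card_n)
  then obtain p q r where "T = {p, q, r}" "p \<noteq> q" "p \<noteq> r" "q \<noteq> r"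
    by (auto simp: card_3_iff)
  with \<open>T \<subseteq> ?S\<close> show False using three_collinear_not_all_vertices[of p q r h] assms by auto
qed

text \<open>An edge is the convex hull of the vertices on it, and these are exactly two, so edges
  inject into pairs of vertices. The bound is crude but suffices to turn four edges into four
  vertices, because three vertices have only three pairs.\<close>

lemma card_edges_le: "card {E. E edge_of P} \<le> card {v. v extreme_point_of P} choose 2"
proof -
  let ?V = "{v. v extreme_point_of P}"
  have hull: "E = convex hull (?V \<inter> E)" if "E edge_of P" for E
  proof -
    have E: "E face_of P" using that by (simp add: edge_of_def)
    have "compact E" "convex E"
      using E polytope polytope_imp_compact polytope_imp_convex face_of_imp_compact face_of_imp_convex
      by metis+
    then have "E = convex hull {v. v extreme_point_of E}" by (rule Krein_Milman_Minkowski)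
    also have "{v. v extreme_point_of E} = ?V \<inter> E" using extreme_point_of_face[OF E] by auto
    finally show ?thesis .
  qed
  have "card {E. E edge_of P} \<le> card {S. S \<subseteq> ?V \<and> card S = 2}"
  proof (rule card_inj_on_le)
    show "inj_on (\<lambda>E. ?V \<inter> E) {E. E edge_of P}"
      by (rule inj_onI) (metis hull mem_Collect_eq)
    show "finite {S. S \<subseteq> ?V \<and> card S = 2}" using finite_vertices by simp
    show "(\<lambda>E. ?V \<inter> E) ` {E. E edge_of P} \<subseteq> {S. S \<subseteq> ?V \<and> card S = 2}"
    proof (clarsimp)
      fix E assume E: "E edge_of P"
      then obtain h where h: "h \<in> F" "E = P \<inter> {x. inner (a h) x = b h}" using edge_iff by auto
      have "?V \<inter> E \<subseteq> ?V \<inter> {x. inner (a h) x = b h}" using h by auto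
      then have "card (?V \<inter> E) \<le> 2"
        using card_vertices_on_edge[OF h(1)] card_mono finite_vertices
        by (meson finite_Int le_trans)
      moreover have "card (?V \<inter> E) \<noteq> 0"
      proof
        assume "card (?V \<inter> E) = 0"
        then have "?V \<inter> E = {}" using finite_vertices by simp
        then have "E = {}" using hull[OF E] by simp
        then show False using E by (simp add: edge_of_def)
      qed
      moreover have "card (?V \<inter> E) \<noteq> 1"
      proof
        assume "card (?V \<inter> E) = 1"
        then obtain x where "?V \<inter> E = {x}" by (auto simp: card_1_singleton_iff)
        then have "E = {x}" using hull[OF E] by simp
        then show False using E by (simp add: edge_of_def)
      qed
      ultimately show "card ({v. v extreme_point_of P} \<inter> E) = 2" by linarith
    qed
  qed
  also have "\<dots> = card ?V choose 2" using finite_vertices by (rule n_subsets)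
  finally show ?thesis .
qed

text \<open>Otherwise the two lines would contain all vertices, at most two on each and
  \<open>v\<close> on both, which leaves at most three.\<close>

lemma nonadjacent_vertex:
  assumes edges: "card {E. E edge_of P} \<ge> 4" and v: "v extreme_point_of P"
    and h: "h1 \<in> F" "h2 \<in> F" "inner (a h1) v = b h1" "inner (a h2) v = b h2"
  shows "\<exists>w. w extreme_point_of P \<and> inner (a h1) w \<noteq> b h1 \<and> inner (a h2) w \<noteq> b h2"
proof (rule ccontr)
  define V where "V = {v. v extreme_point_of P}"
  define A where "A = V \<inter> {x. inner (a h1) x = b h1}"
  define B where "B = V \<inter> {x. inner (a h2) x = b h2}"
  assume "\<not> ?thesis"
  then have V: "V = A \<union> B" unfolding V_def A_def B_def by blast
  have fin: "finite V" using finite_vertices by (simp add: V_def)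
  have le: "card A \<le> 2" "card B \<le> 2"
    using card_vertices_on_edge h unfolding A_def B_def V_def by auto
  have "v \<in> A \<inter> B" using v h by (simp add: A_def B_def V_def)
  moreover have "finite (A \<inter> B)" using fin by (simp add: A_def)
  ultimately have "card (A \<inter> B) > 0" by (metis card_gt_0_iff empty_iff)
  moreover have "card A + card B = card V + card (A \<inter> B)"
    unfolding V using fin by (intro card_Un_Int) (auto simp: A_def B_def)
  ultimately have "card V \<le> 3" using le by linarith
  then have "card V \<in> {0, 1, 2, 3}" by auto
  then have "card V choose 2 \<le> 3" by (auto simp: choose_two)
  then show False using card_edges_le edges unfolding V_def by linarith
qed

text \<open>The inward normal of \<open>h\<close>, scaled by the slack at a point \<open>w\<close>
  off its line; the denominator is negative for \<open>w\<close> strictly inside. With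
  \<open>w\<close> at the other end of a diagonal, the component of the normal along the diagonal is
  fixed, so a line through the vertex is described by a single number.\<close>

definition slack_normal :: "'h \<Rightarrow> real ^ 2 \<Rightarrow> real ^ 2" where
  "slack_normal h w = (1 / (inner (a h) w - b h)) *\<^sub>R a h"

lemma slack_normal:
  assumes "inner (a h) v = b h" "inner (a h) w < b h"
  shows "inner (slack_normal h w) (w - v) = 1"
    and "0 \<le> inner (slack_normal h w) (x - v) \<longleftrightarrow> inner (a h) x \<le> b h"
proof -
  show "inner (slack_normal h w) (w - v) = 1"
    using assms by (simp add: slack_normal_def inner_diff_right flip: diff_divide_distrib)
  have "inner (slack_normal h w) (x - v) = (inner (a h) x - b h) / (inner (a h) w - b h)"
    using assms by (simp add: slack_normal_def inner_diff_right flip: diff_divide_distrib)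
  then show "0 \<le> inner (slack_normal h w) (x - v) \<longleftrightarrow> inner (a h) x \<le> b h"
    using assms(2) by (simp add: zero_le_divide_iff)
qed

lemma slack_normal_inj:
  assumes "h \<in> F" "h' \<in> F" "inner (a h) v = b h" "inner (a h') v = b h'"
    "inner (a h) w < b h" "inner (a h') w < b h'" "slack_normal h w = slack_normal h' w"
  shows "h = h'"
proof -
  define c where "c = (inner (a h) w - b h) / (inner (a h') w - b h')"
  have c: "c > 0" using assms by (simp add: c_def divide_neg_neg)
  have "a h = (inner (a h) w - b h) *\<^sub>R slack_normal h w" using assms(5) by (simp add: slack_normal_def)
  also have "\<dots> = c *\<^sub>R a h'" unfolding assms(7) using assms(6) by (simp add: slack_normal_def c_def)
  finally have "a h = c *\<^sub>R a h'" .
  moreover from this have "b h = c * b h'" using assms(3,4) by (metis inner_scaleR_left)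
  ultimately show ?thesis using halfplane_inj[OF assms(2,1) c] by simp
qed

end

text \<open>The half-planes serve as their own indices, so proportional inequalities have the same
  index. In dimension two the edges are the facets, and a minimal family of half-planes cuts out
  exactly the facets.\<close>

lemma polygon_halfplanes_exists:
  fixes P :: "(real ^ 2) set"
  assumes "polytope P" "aff_dim P = 2"
  obtains F a b where "polygon_halfplanes P (F :: (real^2) set set) a b"
proof -
  have hull: "affine hull P = UNIV" using assms(2) aff_dim_eq_full[of P] by simp
  obtain F where F: "finite F" "P = (affine hull P) \<inter> \<Inter>F"
      "\<forall>h\<in>F. \<exists>a b. a \<noteq> 0 \<and> h = {x. inner a x \<le> b}"
      "\<forall>F'. F' \<subset> F \<longrightarrow> P \<subset> (affine hull P) \<inter> \<Inter>F'"
    using polyhedron_Int_affine_minimal[of P] polytope_imp_polyhedron[OF assms(1)] by auto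
  then obtain a b where ab: "\<And>h. h \<in> F \<Longrightarrow> a h \<noteq> 0 \<and> h = {x. inner (a h) x \<le> b h}" by metis
  have "polygon_halfplanes P F a b"
  proof
    show "P = {x. \<forall>h\<in>F. inner (a h) x \<le> b h}"
    proof -
      have "P = \<Inter>F" using F(2) hull by simp
      also have "\<dots> = {x. \<forall>h\<in>F. inner (a h) x \<le> b h}" using ab by blast
      finally show ?thesis .
    qed
    show "E edge_of P \<longleftrightarrow> (\<exists>h\<in>F. E = P \<inter> {x. inner (a h) x = b h})" for E
    proof -
      have "E edge_of P \<longleftrightarrow> E facet_of P"
        using assms(2) by (auto simp: edge_of_def facet_of_def)
      also have "\<dots> \<longleftrightarrow> (\<exists>h. h \<in> F \<and> E = P \<inter> {x. inner (a h) x = b h})"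
        by (rule facet_of_polyhedron_explicit[OF F(1,2) ab]) (use F(4) in auto)
      finally show ?thesis by auto
    qed
    show "h' = h" if "h \<in> F" "h' \<in> F" "c > 0" "a h' = c *\<^sub>R a h" "b h' = c * b h" for h h' c
    proof -
      have "h' = {x. c * inner (a h) x \<le> c * b h}" using ab[OF that(2)] that by simp
      also have "\<dots> = h" using ab[OF that(1)] that(3) by (simp add: mult_le_cancel_left_pos)
      finally show ?thesis .
    qed
  qed (use assms F ab in auto)
  then show ?thesis by (rule that)
qed

text \<open>The form in which the polygon is used from here on: four normalised edges at the ends of
  a diagonal, and a finite rest \<open>H\<close> that is strict at both ends and therefore along the
  whole diagonal.\<close>

lemma polygon_two_vertices:
  fixes P :: "(real ^ 2) set"
  assumes "polytope P" "aff_dim P = 2" "card {E. E edge_of P} \<ge> 4" "v extreme_point_of P"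
  obtains w a1 a2 b1 b2 and H :: "((real ^ 2) \<times> real) set" where
    "a1 \<noteq> a2" "inner a1 (w - v) = 1" "inner a2 (w - v) = 1"
    "b1 \<noteq> b2" "inner b1 (v - w) = 1" "inner b2 (v - w) = 1"
    "finite H" "\<And>h. h \<in> H \<Longrightarrow> inner (fst h) v < snd h" "\<And>h. h \<in> H \<Longrightarrow> inner (fst h) w < snd h"
    "P = {x. 0 \<le> inner a1 (x - v) \<and> 0 \<le> inner a2 (x - v) \<and> 0 \<le> inner b1 (x - w) \<and> 0 \<le> inner b2 (x - w)
      \<and> (\<forall>h\<in>H. inner (fst h) x \<le> snd h)}"
proof -
  obtain F :: "(real^2) set set" and a b where "polygon_halfplanes P F a b"
    using polygon_halfplanes_exists[OF assms(1,2)] .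
  then interpret polygon_halfplanes P F a b .
  obtain h1 h2 where h: "h1 \<in> F" "h2 \<in> F" "h1 \<noteq> h2" "inner (a h1) v = b h1" "inner (a h2) v = b h2"
    using vertex_two_edges[OF assms(4)] .
  obtain w where w: "w extreme_point_of P" "inner (a h1) w \<noteq> b h1" "inner (a h2) w \<noteq> b h2"
    using nonadjacent_vertex[OF assms(3,4) h(1,2,4,5)] by auto
  obtain g1 g2 where g: "g1 \<in> F" "g2 \<in> F" "g1 \<noteq> g2" "inner (a g1) w = b g1" "inner (a g2) w = b g2"
    using vertex_two_edges[OF w(1)] .
  have P: "v \<in> P" "w \<in> P" using assms(4) w(1) by (auto simp: extreme_point_of_def)
  have actv: "h = h1 \<or> h = h2" if "h \<in> F" "inner (a h) v = b h" for h
    using at_most_two_edges_at_point[OF P(1) h(1,2) that(1) h(4,5) that(2) h(3)] .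
  have actw: "h = g1 \<or> h = g2" if "h \<in> F" "inner (a h) w = b h" for h
    using at_most_two_edges_at_point[OF P(2) g(1,2) that(1) g(4,5) that(2) g(3)] .
  have le: "inner (a h) v \<le> b h" "inner (a h) w \<le> b h" if "h \<in> F" for h
    using P that unfolding P_eq by auto
  have hw: "inner (a h1) w < b h1" "inner (a h2) w < b h2" using w le h by force+
  \<comment> \<open>An edge through both \<open>w\<close> and \<open>v\<close> would be
    \<open>h1\<close> or \<open>h2\<close>, and \<open>w\<close> was chosen on neither.\<close>
  have gv: "inner (a g1) v < b g1" "inner (a g2) v < b g2"
    using actv[OF g(1)] actv[OF g(2)] g(4,5) w(2,3) le g(1,2) by force+
  define H where "H = (\<lambda>h. (a h, b h)) ` (F - {h1, h2, g1, g2})"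
  show thesis
  proof (rule that)
    show "slack_normal h1 w \<noteq> slack_normal h2 w"
      using slack_normal_inj[OF h(1,2,4,5) hw] h(3) by blast
    show "slack_normal g1 v \<noteq> slack_normal g2 v"
      using slack_normal_inj[OF g(1,2,4,5) gv] g(3) by blast
    show "finite H" using finite_F by (simp add: H_def)
    show "inner (fst k) v < snd k" "inner (fst k) w < snd k" if kH: "k \<in> H" for k
    proof -
      obtain h where k: "k = (a h, b h)" "h \<in> F" "h \<notin> {h1, h2, g1, g2}"
        using kH unfolding H_def by blast
      have "inner (a h) v \<noteq> b h" "inner (a h) w \<noteq> b h" using actv actw k by blast+
      with le[OF k(2)] show "inner (fst k) v < snd k" "inner (fst k) w < snd k"
        unfolding k(1) by simp_all
    qed
    have mem_P: "x \<in> P \<longleftrightarrow> inner (a h1) x \<le> b h1 \<and> inner (a h2) x \<le> b h2 \<and> inner (a g1) x \<le> b g1 \<and>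
        inner (a g2) x \<le> b g2 \<and> (\<forall>h\<in>H. inner (fst h) x \<le> snd h)" for x
    proof -
      have "(\<forall>h\<in>H. inner (fst h) x \<le> snd h) \<longleftrightarrow> (\<forall>h\<in>F - {h1, h2, g1, g2}. inner (a h) x \<le> b h)"
        by (simp add: H_def)
      moreover have "x \<in> P \<longleftrightarrow> (\<forall>h\<in>F. inner (a h) x \<le> b h)" using P_eq by blast
      ultimately show ?thesis using h(1,2) g(1,2) by blast
    qed
    show "P = {x. 0 \<le> inner (slack_normal h1 w) (x - v) \<and> 0 \<le> inner (slack_normal h2 w) (x - v) \<and>
        0 \<le> inner (slack_normal g1 v) (x - w) \<and> 0 \<le> inner (slack_normal g2 v) (x - w)
        \<and> (\<forall>h\<in>H. inner (fst h) x \<le> snd h)}"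
      unfolding set_eq_iff by (simp only: mem_P mem_Collect_eq slack_normal(2)[OF h(4) hw(1)]
        slack_normal(2)[OF h(5) hw(2)] slack_normal(2)[OF g(4) gv(1)] slack_normal(2)[OF g(5) gv(2)] simp_thms)
  qed (rule slack_normal(1)[OF h(4) hw(1)] slack_normal(1)[OF h(5) hw(2)]
        slack_normal(1)[OF g(4) gv(1)] slack_normal(1)[OF g(5) gv(2)])+
qed

section \<open>Pencils and matrix convex combinations\<close>

lemma msum_carrier [simp]: "msum n I A \<in> carrier_mat n n"
  by (simp add: msum_def)

lemma dim_msum [simp]: "dim_row (msum n I A) = n" "dim_col (msum n I A) = n"
  by (simp_all add: msum_def)

lemma index_msum [simp]: "i < n \<Longrightarrow> j < n \<Longrightarrow> msum n I A $$ (i, j) = (\<Sum>l\<in>I. A l $$ (i, j))"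
  by (simp add: msum_def)

lemma msum_mult_vec:
  assumes "\<And>l. l \<in> I \<Longrightarrow> A l \<in> carrier_mat n n" "u \<in> carrier_vec n" "i < n"
  shows "vec_index (msum n I A *\<^sub>v u) i = (\<Sum>l\<in>I. vec_index (A l *\<^sub>v u) i)"
proof -
  have "vec_index (msum n I A *\<^sub>v u) i = (\<Sum>j<n. \<Sum>l\<in>I. A l $$ (i, j) * vec_index u j)"
    using assms by (simp add: scalar_prod_def sum_distrib_right atLeast0LessThan)
  also have "\<dots> = (\<Sum>l\<in>I. \<Sum>j<n. A l $$ (i, j) * vec_index u j)" by (rule sum.swap)
  also have "\<dots> = (\<Sum>l\<in>I. vec_index (A l *\<^sub>v u) i)"
  proof (rule sum.cong)
    fix l assume "l \<in> I"
    then have "A l \<in> carrier_mat n n" by (rule assms(1))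
    then show "(\<Sum>j<n. A l $$ (i, j) * vec_index u j) = vec_index (A l *\<^sub>v u) i"
      using assms(2,3) by (simp add: scalar_prod_def atLeast0LessThan)
  qed simp
  finally show ?thesis .
qed

lemma scalar_prod_msum_mult_vec:
  assumes "\<And>l. l \<in> I \<Longrightarrow> A l \<in> carrier_mat n n" "u \<in> carrier_vec n" "w \<in> carrier_vec n"
  shows "scalar_prod w (msum n I A *\<^sub>v u) = (\<Sum>l\<in>I. scalar_prod w (A l *\<^sub>v u))"
proof -
  have "scalar_prod w (msum n I A *\<^sub>v u) = (\<Sum>i<n. vec_index w i * vec_index (msum n I A *\<^sub>v u) i)"
    by (simp add: scalar_prod_def atLeast0LessThan)
  also have "\<dots> = (\<Sum>i<n. \<Sum>l\<in>I. vec_index w i * vec_index (A l *\<^sub>v u) i)"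
    using assms(1,2) by (intro sum.cong refl) (simp only: msum_mult_vec[of I A n] lessThan_iff sum_distrib_left)
  also have "\<dots> = (\<Sum>l\<in>I. \<Sum>i<n. vec_index w i * vec_index (A l *\<^sub>v u) i)" by (rule sum.swap)
  also have "\<dots> = (\<Sum>l\<in>I. scalar_prod w (A l *\<^sub>v u))"
  proof (rule sum.cong)
    fix l assume "l \<in> I"
    then have "A l \<in> carrier_mat n n" by (rule assms(1))
    then show "(\<Sum>i<n. vec_index w i * vec_index (A l *\<^sub>v u) i) = scalar_prod w (A l *\<^sub>v u)"
      by (simp add: scalar_prod_def[of w] atLeast0LessThan)
  qed simp
  finally show ?thesis .
qed

lemma scalar_prod_conj_mult_vec:
  fixes A :: "real mat"
  assumes "V \<in> carrier_mat N n" "A \<in> carrier_mat N N" "u \<in> carrier_vec n" "w \<in> carrier_vec n"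
  shows "scalar_prod w ((transpose_mat V * A * V) *\<^sub>v u)
    = scalar_prod (V *\<^sub>v w) (A *\<^sub>v (V *\<^sub>v u))"
proof -
  have Au: "A *\<^sub>v (V *\<^sub>v u) \<in> carrier_vec N" and Vu: "V *\<^sub>v u \<in> carrier_vec N"
    and T_A: "transpose_mat V * A \<in> carrier_mat n N" using assms by auto
  have "(transpose_mat V * A * V) *\<^sub>v u = transpose_mat V *\<^sub>v (A *\<^sub>v (V *\<^sub>v u))"
    using assms assoc_mult_mat_vec[of "transpose_mat V * A" n N V n u]
      assoc_mult_mat_vec[of "transpose_mat V" n N A N "V *\<^sub>v u"] by (metis Vu T_A transpose_carrier_mat)
  moreover have "scalar_prod w (transpose_mat V *\<^sub>v (A *\<^sub>v (V *\<^sub>v u)))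
      = scalar_prod (transpose_mat V *\<^sub>v (A *\<^sub>v (V *\<^sub>v u))) w"
    using assms Au by (intro comm_scalar_prod) auto
  moreover have "\<dots> = scalar_prod (A *\<^sub>v (V *\<^sub>v u)) (V *\<^sub>v w)"
    using transpose_vec_mult_scalar[OF assms(1) assms(4) Au] .
  moreover have "\<dots> = scalar_prod (V *\<^sub>v w) (A *\<^sub>v (V *\<^sub>v u))"
    using assms Au by (intro comm_scalar_prod[of _ N]) auto
  ultimately show ?thesis by simp
qed

lemma scalar_prod_self_nonneg: "0 \<le> scalar_prod v v" for v :: "real vec"
  by (simp add: scalar_prod_def sum_nonneg)

lemma scalar_prod_self_eq_0_iff:
  "v \<in> carrier_vec n \<Longrightarrow> scalar_prod v v = 0 \<longleftrightarrow> v = 0\<^sub>v n" for v :: "real vec"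
  by (auto simp: scalar_prod_def sum_nonneg_eq_0_iff intro!: eq_vecI)

definition pencil :: "nat \<Rightarrow> real \<Rightarrow> ('g \<Rightarrow> real) \<Rightarrow> ('g::finite) mat_tuple \<Rightarrow> real mat" where
  "pencil n a0 a X = a0 \<cdot>\<^sub>m 1\<^sub>m n + msum n UNIV (\<lambda>k. a k \<cdot>\<^sub>m X k)"

lemma pencil_carrier [simp]: "pencil n a0 a X \<in> carrier_mat n n"
  by (simp add: pencil_def)

lemma SM_carrier: "X \<in> SM n \<Longrightarrow> X k \<in> carrier_mat n n"
  and SM_transpose: "X \<in> SM n \<Longrightarrow> transpose_mat (X k) = X k"
  by (auto simp: SM_def)

lemma SM_unique: "X \<in> SM n \<Longrightarrow> X \<in> SM m \<Longrightarrow> m = n"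
  by (metis SM_carrier carrier_matD(1))

lemma SM_sym:
  assumes "X \<in> SM n" "i < n" "j < n" shows "X k $$ (i, j) = X k $$ (j, i)"
  using SM_transpose[OF assms(1), of k] SM_carrier[OF assms(1), of k] assms(2,3)
  by (metis carrier_matD index_transpose_mat(1))

lemma pencil_transpose: "X \<in> SM n \<Longrightarrow> transpose_mat (pencil n a0 a X) = pencil n a0 a X"
  by (rule eq_matI) (auto simp: pencil_def SM_carrier[THEN carrier_matD(1)]
      SM_carrier[THEN carrier_matD(2)] SM_sym[of X n] intro!: sum.cong)

lemma smult_mat_mult_vec:
  fixes A :: "real mat"
  assumes "A \<in> carrier_mat n m" "u \<in> carrier_vec m"
  shows "c \<cdot>\<^sub>m A *\<^sub>v u = c \<cdot>\<^sub>v (A *\<^sub>v u)"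
  using assms by (intro eq_vecI) auto

lemma pencil_mult_vec:
  assumes "X \<in> SM n" "u \<in> carrier_vec n" "i < n"
  shows "vec_index (pencil n a0 a X *\<^sub>v u) i = a0 * vec_index u i + (\<Sum>k\<in>UNIV. a k * vec_index (X k *\<^sub>v u) i)"
proof -
  have "vec_index (a k \<cdot>\<^sub>m X k *\<^sub>v u) i = a k * vec_index (X k *\<^sub>v u) i" for k
    using SM_carrier[OF assms(1), of k] assms(2,3) by (simp add: smult_mat_mult_vec[of _ n n])
  moreover have "pencil n a0 a X *\<^sub>v u = (a0 \<cdot>\<^sub>m 1\<^sub>m n) *\<^sub>v u + msum n UNIV (\<lambda>k. a k \<cdot>\<^sub>m X k) *\<^sub>v u"
    unfolding pencil_def using assms(2) by (intro add_mult_distrib_mat_vec[of _ n n]) auto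
  moreover have "(a0 \<cdot>\<^sub>m 1\<^sub>m n) *\<^sub>v u = a0 \<cdot>\<^sub>v u"
    using assms(2) by (simp add: smult_mat_mult_vec[of _ n n])
  ultimately show ?thesis
    using assms SM_carrier[OF assms(1)] by (simp add: msum_mult_vec del: index_mult_mat_vec) 
qed

lemma scalar_prod_pencil:
  assumes "X \<in> SM n" "u \<in> carrier_vec n" "w \<in> carrier_vec n"
  shows "scalar_prod w (pencil n a0 a X *\<^sub>v u)
    = a0 * scalar_prod w u + (\<Sum>k\<in>UNIV. a k * scalar_prod w (X k *\<^sub>v u))"
proof -
  have d: "dim_vec (pencil n a0 a X *\<^sub>v u) = n" "dim_vec (X k *\<^sub>v u) = n" for k
    using SM_carrier[OF assms(1), of k] carrier_matD(1)[OF pencil_carrier[of n a0 a X]] by auto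
  have "scalar_prod w (pencil n a0 a X *\<^sub>v u)
      = (\<Sum>i<n. vec_index w i * (a0 * vec_index u i + (\<Sum>k\<in>UNIV. a k * vec_index (X k *\<^sub>v u) i)))"
    unfolding scalar_prod_def d using assms by (simp add: pencil_mult_vec atLeast0LessThan del: index_mult_mat_vec)
  also have "\<dots> = a0 * (\<Sum>i<n. vec_index w i * vec_index u i)
      + (\<Sum>i<n. \<Sum>k\<in>UNIV. a k * (vec_index w i * vec_index (X k *\<^sub>v u) i))"
    by (simp add: sum.distrib sum_distrib_left algebra_simps)
  also have "(\<Sum>i<n. \<Sum>k\<in>UNIV. a k * (vec_index w i * vec_index (X k *\<^sub>v u) i))
      = (\<Sum>k\<in>UNIV. a k * (\<Sum>i<n. vec_index w i * vec_index (X k *\<^sub>v u) i))"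
    by (subst sum.swap) (simp add: sum_distrib_left)
  finally show ?thesis using assms(2) unfolding scalar_prod_def d by (simp add: atLeast0LessThan)
qed

lemma Wmax_iff:
  assumes "X \<in> SM n" "n \<ge> 1"
  shows "X \<in> Wmax C \<longleftrightarrow> (\<forall>a0 a. (\<forall>x\<in>C. 0 \<le> a0 + (\<Sum>k\<in>UNIV. a k * vec_nth x k)) \<longrightarrow>
    psd n (pencil n a0 a X))"
  using assms SM_unique[OF assms(1)] unfolding Wmax_def pencil_def by blast

lemma Wmax_I:
  assumes "X \<in> SM n" "n \<ge> 1"
    and "\<And>a0 a u. \<lbrakk>\<forall>x\<in>C. 0 \<le> a0 + (\<Sum>k\<in>UNIV. a k * vec_nth x k); u \<in> carrier_vec n\<rbrakk>
      \<Longrightarrow> 0 \<le> scalar_prod u (pencil n a0 a X *\<^sub>v u)"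
  shows "X \<in> Wmax C"
  unfolding Wmax_iff[OF assms(1,2)] psd_def using assms by (auto simp: pencil_transpose)

text \<open>The form attains its minimum 0 at \<open>u\<close>, so its derivative there vanishes.
  The derivative in the direction \<open>w = A u\<close> is twice the squared norm \<open>c\<close>
  of \<open>w\<close>.\<close>

lemma psd_kernel:
  assumes "psd n A" "u \<in> carrier_vec n" "scalar_prod u (A *\<^sub>v u) = 0"
  shows "A *\<^sub>v u = 0\<^sub>v n"
proof -
  have A: "A \<in> carrier_mat n n" "transpose_mat A = A"
    and pos: "\<And>v. v \<in> carrier_vec n \<Longrightarrow> 0 \<le> scalar_prod v (A *\<^sub>v v)"
    using assms(1) by (auto simp: psd_def)
  define w where "w = A *\<^sub>v u"
  define c where "c = scalar_prod w w"
  define d where "d = scalar_prod w (A *\<^sub>v w)"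
  have w: "w \<in> carrier_vec n" "A *\<^sub>v w \<in> carrier_vec n" using A assms(2) by (auto simp: w_def)
  have d0: "d \<ge> 0" using pos[OF w(1)] by (simp add: d_def)
  have uAw: "scalar_prod u (A *\<^sub>v w) = c"
  proof -
    have "scalar_prod (transpose_mat A *\<^sub>v u) w = scalar_prod u (A *\<^sub>v w)"
      by (rule transpose_vec_mult_scalar[OF A(1) w(1) assms(2)])
    then show ?thesis using A(2) by (simp add: c_def w_def)
  qed
  have expand: "scalar_prod (u + t \<cdot>\<^sub>v w) (A *\<^sub>v (u + t \<cdot>\<^sub>v w)) = 2 * t * c + t\<^sup>2 * d" for t
  proof -
    have "A *\<^sub>v (u + t \<cdot>\<^sub>v w) = w + t \<cdot>\<^sub>v (A *\<^sub>v w)"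
      using A(1) assms(2) w by (simp add: mult_add_distrib_mat_vec mult_mat_vec w_def)
    then show ?thesis using assms(2,3) w uAw
      by (simp add: scalar_prod_add_distrib[of _ n] add_scalar_prod_distrib[of _ n]
          w_def[symmetric] c_def[symmetric] d_def[symmetric] power2_eq_square algebra_simps)
  qed
  have "c = 0"
  proof (rule ccontr)
    assume "c \<noteq> 0"
    \<comment> \<open>A step against the sign of \<open>c\<close>, short enough for the linear term
      to win; the \<open>+ 1\<close> avoids a division by zero when \<open>d = 0\<close>.\<close>
    define t where "t = - c / (d + 1)"
    have t: "c = - t * (d + 1)" "t \<noteq> 0" using d0 \<open>c \<noteq> 0\<close> by (auto simp: t_def)
    have "0 \<le> 2 * t * c + t\<^sup>2 * d"
      using pos[of "u + t \<cdot>\<^sub>v w"] assms(2) w expand[of t] by simp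
    also have "\<dots> = - (t\<^sup>2 * (d + 2))"
      unfolding t(1) by (simp add: algebra_simps power2_eq_square)
    also have "\<dots> < 0" using d0 t(2) by simp
    finally show False by simp
  qed
  then show ?thesis using scalar_prod_self_eq_0_iff[OF w(1)] by (simp add: c_def w_def)
qed

section \<open>Compressions and kernels of pencils\<close>

lemma conj_tuple_SM:
  assumes "X \<in> SM N" "W \<in> carrier_mat N n" shows "conj_tuple W X \<in> SM n"
proof -
  have "transpose_mat (transpose_mat W * X k * W) = transpose_mat W * X k * W" for k
  proof -
    note c = SM_carrier[OF assms(1), of k] assms(2)
    have "transpose_mat (transpose_mat W * X k * W) = transpose_mat W * transpose_mat (transpose_mat W * X k)"
      by (rule transpose_mult[of _ n N _ n]) (use c in auto)
    also have "transpose_mat (transpose_mat W * X k) = transpose_mat (X k) * W"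
      using transpose_mult[of "transpose_mat W" n N "X k" N] c by simp
    finally show ?thesis using c SM_transpose[OF assms(1), of k]
      by (simp add: assoc_mult_mat[of "transpose_mat W" n N "X k" N W n])
  qed
  moreover have "transpose_mat W * X k * W \<in> carrier_mat n n" for k
    using SM_carrier[OF assms(1), of k] assms(2) by auto
  ultimately show ?thesis by (simp add: SM_def conj_tuple_def)
qed

lemma matrix_convex_combD:
  assumes "matrix_convex_comb K n X m N V Y" "l < m"
  shows "Y l \<in> K" "Y l \<in> SM (N l)" "V l \<in> carrier_mat (N l) n"
  using assms by (auto simp: matrix_convex_comb_def level_def)

text \<open>The pencil at \<open>X\<close> is the sum of the compressions by \<open>V l\<close> of
  the same pencil at \<open>Y l\<close>. The constant term fits in because the Gram matrices of the
  \<open>V l\<close> sum to the identity.\<close>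

lemma scalar_prod_pencil_comb:
  assumes comb: "matrix_convex_comb K n X m N V Y" and X: "X \<in> SM n" and u: "u \<in> carrier_vec n"
  shows "scalar_prod u (pencil n a0 a X *\<^sub>v u)
    = (\<Sum>l<m. scalar_prod (V l *\<^sub>v u) (pencil (N l) a0 a (Y l) *\<^sub>v (V l *\<^sub>v u)))"
proof -
  note D = matrix_convex_combD[OF comb]
  have Vu: "V l *\<^sub>v u \<in> carrier_vec (N l)" if "l < m" for l using D(3)[OF that] u by simp
  have "scalar_prod u u = scalar_prod u (msum n {..<m} (\<lambda>l. transpose_mat (V l) * V l) *\<^sub>v u)"
    using comb u by (simp add: matrix_convex_comb_def)
  also have "\<dots> = (\<Sum>l<m. scalar_prod u ((transpose_mat (V l) * V l) *\<^sub>v u))"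
    using D(3) u by (intro scalar_prod_msum_mult_vec mult_carrier_mat[of _ n]) auto
  also have "\<dots> = (\<Sum>l<m. scalar_prod (V l *\<^sub>v u) (V l *\<^sub>v u))"
  proof (rule sum.cong)
    fix l assume "l \<in> {..<m}"
    then have V: "V l \<in> carrier_mat (N l) n" using D(3) by simp
    have "transpose_mat (V l) * V l = transpose_mat (V l) * 1\<^sub>m (N l) * V l"
      using V by simp
    then show "scalar_prod u ((transpose_mat (V l) * V l) *\<^sub>v u) = scalar_prod (V l *\<^sub>v u) (V l *\<^sub>v u)"
      using scalar_prod_conj_mult_vec[OF V one_carrier_mat u u] V u by simp
  qed simp
  finally have uu: "scalar_prod u u = (\<Sum>l<m. scalar_prod (V l *\<^sub>v u) (V l *\<^sub>v u))" .
  have Xu: "scalar_prod u (X k *\<^sub>v u) = (\<Sum>l<m. scalar_prod (V l *\<^sub>v u) (Y l k *\<^sub>v (V l *\<^sub>v u)))" for k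
  proof -
    have "scalar_prod u (X k *\<^sub>v u) = scalar_prod u (msum n {..<m} (\<lambda>l. conj_tuple (V l) (Y l) k) *\<^sub>v u)"
      using comb by (simp add: matrix_convex_comb_def)
    also have "\<dots> = (\<Sum>l<m. scalar_prod u (conj_tuple (V l) (Y l) k *\<^sub>v u))"
      using SM_carrier[OF conj_tuple_SM[OF D(2,3)]] u by (intro scalar_prod_msum_mult_vec) auto
    also have "\<dots> = (\<Sum>l<m. scalar_prod (V l *\<^sub>v u) (Y l k *\<^sub>v (V l *\<^sub>v u)))"
      unfolding conj_tuple_def using u
      by (intro sum.cong refl scalar_prod_conj_mult_vec[OF D(3)] SM_carrier[OF D(2)]) auto
    finally show ?thesis .
  qed
  have "scalar_prod u (pencil n a0 a X *\<^sub>v u) = (\<Sum>l<m. a0 * scalar_prod (V l *\<^sub>v u) (V l *\<^sub>v u)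
      + (\<Sum>k\<in>UNIV. a k * scalar_prod (V l *\<^sub>v u) (Y l k *\<^sub>v (V l *\<^sub>v u))))"
    unfolding scalar_prod_pencil[OF X u u] uu Xu
    by (simp add: sum.distrib sum_distrib_left sum.swap[of _ UNIV])
  also have "\<dots> = (\<Sum>l<m. scalar_prod (V l *\<^sub>v u) (pencil (N l) a0 a (Y l) *\<^sub>v (V l *\<^sub>v u)))"
    using D(2) Vu by (intro sum.cong refl) (simp add: scalar_prod_pencil)
  finally show ?thesis .
qed

text \<open>On a kernel vector the sum of the compressed forms is zero. Its summands are nonnegative
  since each \<open>Y l\<close> lies in \<open>Wmax C\<close>, so all of them vanish, and a zero of
  a positive semidefinite form is a kernel vector.\<close>

lemma pencil_kernel_comb:
  assumes comb: "matrix_convex_comb (Wmax C) n X m N V Y" and X: "X \<in> SM n" and u: "u \<in> carrier_vec n"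
    and C: "\<forall>x\<in>C. 0 \<le> a0 + (\<Sum>k\<in>UNIV. a k * vec_nth x k)"
    and ker: "pencil n a0 a X *\<^sub>v u = 0\<^sub>v n" and l: "l < m"
  shows "pencil (N l) a0 a (Y l) *\<^sub>v (V l *\<^sub>v u) = 0\<^sub>v (N l)"
proof -
  note D = matrix_convex_combD[OF comb]
  have Vu: "V l *\<^sub>v u \<in> carrier_vec (N l)" if "l < m" for l using D(3)[OF that] u by simp
  have psd: "psd (N l) (pencil (N l) a0 a (Y l))" if l: "l < m" for l
  proof -
    \<comment> \<open>\<open>level\<close> puts no lower bound on the size; that \<open>N l\<close>
      is at least 1 comes from membership in \<open>Wmax C\<close>.\<close>
    obtain n' where "Y l \<in> SM n'" "n' \<ge> 1" using D(1)[OF l] by (auto simp: Wmax_def)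
    then have "N l \<ge> 1" using SM_unique D(2)[OF l] by metis
    then show ?thesis using Wmax_iff[OF D(2)[OF l], of C] D(1)[OF l] C by blast
  qed
  have "(\<Sum>l<m. scalar_prod (V l *\<^sub>v u) (pencil (N l) a0 a (Y l) *\<^sub>v (V l *\<^sub>v u))) = 0"
    unfolding scalar_prod_pencil_comb[OF comb X u, symmetric] ker using u by simp
  moreover have "0 \<le> scalar_prod (V l *\<^sub>v u) (pencil (N l) a0 a (Y l) *\<^sub>v (V l *\<^sub>v u))" if "l < m" for l
    using psd[OF that] Vu[OF that] by (simp add: psd_def)
  ultimately have "scalar_prod (V l *\<^sub>v u) (pencil (N l) a0 a (Y l) *\<^sub>v (V l *\<^sub>v u)) = 0"
    using l by (subst (asm) sum_nonneg_eq_0_iff) auto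
  then show ?thesis by (rule psd_kernel[OF psd[OF l] Vu[OF l]])
qed

text \<open>The case of a single summand. It transfers the pencil identity to compressions, and
  later places a point of an ellipse in the matrix convex hull.\<close>

lemma matrix_convex_comb_compression:
  assumes "X \<in> K" "X \<in> SM N" "W \<in> carrier_mat N n" "transpose_mat W * W = 1\<^sub>m n"
  shows "matrix_convex_comb K n (conj_tuple W X) (Suc 0) (\<lambda>_. N) (\<lambda>_. W) (\<lambda>_. X)"
proof -
  have "msum n {..<Suc 0} (\<lambda>_. A) = A" if "A \<in> carrier_mat n n" for A
    using that by (intro eq_matI) auto
  moreover have "conj_tuple W X k \<in> carrier_mat n n" for k
    using SM_carrier[OF conj_tuple_SM[OF assms(2,3)]] .
  ultimately show ?thesis using assms by (simp add: matrix_convex_comb_def level_def)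
qed

lemma Wmax_compression:
  assumes "X \<in> Wmax C" "X \<in> SM N" "W \<in> carrier_mat N n" "transpose_mat W * W = 1\<^sub>m n" "n \<ge> 1"
  shows "conj_tuple W X \<in> Wmax C"
proof (rule Wmax_I[OF conj_tuple_SM[OF assms(2,3)] assms(5)])
  fix a0 and a :: "'a \<Rightarrow> real" and u :: "real vec"
  assume C: "\<forall>x\<in>C. 0 \<le> a0 + (\<Sum>k\<in>UNIV. a k * vec_nth x k)" and u: "u \<in> carrier_vec n"
  obtain n' where "X \<in> SM n'" "n' \<ge> 1" using assms(1) by (auto simp: Wmax_def)
  then have "N \<ge> 1" using SM_unique assms(2) by metis
  then have "psd N (pencil N a0 a X)" using Wmax_iff[OF assms(2)] assms(1) C by blast
  then have "0 \<le> scalar_prod (W *\<^sub>v u) (pencil N a0 a X *\<^sub>v (W *\<^sub>v u))"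
    using assms(3) u by (simp add: psd_def)
  then show "0 \<le> scalar_prod u (pencil n a0 a (conj_tuple W X) *\<^sub>v u)"
    using scalar_prod_pencil_comb[OF matrix_convex_comb_compression[OF assms(1-4)]
        conj_tuple_SM[OF assms(2,3)] u] by simp
qed

section \<open>Free extreme points of the maximal matrix convex set\<close>

lemma wide_matrix_kernel:
  fixes A :: "real mat"
  assumes A: "A \<in> carrier_mat r c" and "r < c"
  obtains v where "v \<in> carrier_vec c" "v \<noteq> 0\<^sub>v c" "A *\<^sub>v v = 0\<^sub>v r"
proof -
  \<comment> \<open>Padding with zero rows makes the matrix square. Row \<open>r\<close> of
    \<open>B\<close> is zero, so the transpose annihilates a unit vector and the determinant
    vanishes.\<close>
  define B where "B = mat c c (\<lambda>(i, j). if i < r then A $$ (i, j) else 0)"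
  have B: "B \<in> carrier_mat c c" by (simp add: B_def)
  have "transpose_mat B *\<^sub>v unit_vec c r = 0\<^sub>v c"
    using \<open>r < c\<close> by (intro eq_vecI) (auto simp: B_def)
  moreover have "unit_vec c r \<noteq> (0\<^sub>v c :: real vec)" using \<open>r < c\<close> by simp
  moreover have "transpose_mat B \<in> carrier_mat c c" using B by simp
  ultimately have "det (transpose_mat B) = 0"
    using det_0_iff_vec_prod_zero[of "transpose_mat B" c] unit_vec_carrier[of c r] by metis
  then have "det B = 0" using det_transpose[OF B] by simp
  then obtain v where v: "v \<in> carrier_vec c" "v \<noteq> 0\<^sub>v c" "B *\<^sub>v v = 0\<^sub>v c"
    using det_0_iff_vec_prod_zero[OF B] by blast
  have "A *\<^sub>v v = 0\<^sub>v r"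
  proof (rule eq_vecI)
    fix i assume "i < dim_vec (0\<^sub>v r :: real vec)"
    then have i: "i < r" by simp
    have "vec_index (A *\<^sub>v v) i = vec_index (B *\<^sub>v v) i"
      using A v(1) i \<open>r < c\<close> by (simp add: B_def scalar_prod_def)
    also have "\<dots> = 0" using v(3) i \<open>r < c\<close> by simp
    finally show "vec_index (A *\<^sub>v v) i = vec_index (0\<^sub>v r) i" using i by simp
  qed (use A in simp)
  with v(1,2) show ?thesis by (rule that)
qed

lemma isometry_dim_le:
  fixes W :: "real mat"
  assumes W: "W \<in> carrier_mat N n" "transpose_mat W * W = 1\<^sub>m n"
  shows "n \<le> N"
proof (rule ccontr)
  assume "\<not> n \<le> N"
  then obtain v where v: "v \<in> carrier_vec n" "v \<noteq> 0\<^sub>v n" "W *\<^sub>v v = 0\<^sub>v N"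
    using wide_matrix_kernel[OF W(1)] by (metis not_le)
  have "v = transpose_mat W *\<^sub>v (W *\<^sub>v v)"
    using assoc_mult_mat_vec[of "transpose_mat W" n N W n v] W v(1) by simp
  also have "\<dots> = 0\<^sub>v n" unfolding v(3) using W by (intro eq_vecI) auto
  finally show False using v(2) by simp
qed

lemma isometry_add_column:
  fixes W :: "real mat"
  assumes W: "W \<in> carrier_mat N n" "transpose_mat W * W = 1\<^sub>m n" and "n < N"
  obtains W' where "W' \<in> carrier_mat N (Suc n)" "transpose_mat W' * W' = 1\<^sub>m (Suc n)"
    "\<And>i j. i < N \<Longrightarrow> j < n \<Longrightarrow> W' $$ (i, j) = W $$ (i, j)"
proof -
  \<comment> \<open>The transpose of \<open>W\<close> is wide, so some nonzero vector is orthogonal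
    to all columns of \<open>W\<close>; normalised, it becomes the new column.\<close>
  obtain v where v: "v \<in> carrier_vec N" "v \<noteq> 0\<^sub>v N" "transpose_mat W *\<^sub>v v = 0\<^sub>v n"
    using wide_matrix_kernel[of "transpose_mat W" n N] W(1) \<open>n < N\<close> by auto
  define s where "s = sqrt (scalar_prod v v)"
  have "scalar_prod v v > 0"
    using scalar_prod_self_eq_0_iff[OF v(1)] scalar_prod_self_nonneg[of v] v(2) by linarith
  then have s: "s > 0" "scalar_prod v v = s * s" by (simp_all add: s_def)
  define W' where "W' = mat N (Suc n) (\<lambda>(i, j). if j < n then W $$ (i, j) else vec_index v i / s)"
  have colW': "col W' j = (if j < n then col W j else (1 / s) \<cdot>\<^sub>v v)" if "j < Suc n" for j
    using that W(1) v(1) by (auto simp: W'_def)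
  have WW: "scalar_prod (col W i) (col W j) = (if i = j then 1 else 0)" if "i < n" "j < n" for i j
  proof -
    have "(transpose_mat W * W) $$ (i, j) = (if i = j then 1 else 0)" using that W(2) by simp
    then show ?thesis using that W(1) by simp
  qed
  have Wv: "scalar_prod (col W i) v = 0" "scalar_prod v (col W i) = 0" if "i < n" for i
  proof -
    have "vec_index (transpose_mat W *\<^sub>v v) i = 0" using v(3) that by simp
    then show *: "scalar_prod (col W i) v = 0" using that W(1) by simp
    then show "scalar_prod v (col W i) = 0"
      using comm_scalar_prod[of "col W i" N v] W(1) v(1) that by auto
  qed
  have "transpose_mat W' * W' = 1\<^sub>m (Suc n)"
  proof (rule eq_matI)
    fix i j assume "i < dim_row (1\<^sub>m (Suc n) :: real mat)" "j < dim_col (1\<^sub>m (Suc n) :: real mat)"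
    then have ij: "i < Suc n" "j < Suc n" by auto
    have cW: "col W i \<in> carrier_vec N" if "i < n" for i using W(1) that by auto
    have "(transpose_mat W' * W') $$ (i, j) = scalar_prod (col W' i) (col W' j)"
      using ij by (simp add: W'_def)
    also have "\<dots> = (if i = j then 1 else 0)"
      unfolding colW'[OF ij(1)] colW'[OF ij(2)] using ij WW Wv s v(1) cW
      by (auto simp: not_less less_Suc_eq_le smult_scalar_prod_distrib[of _ N] scalar_prod_smult_distrib[of _ N])
    finally show "(transpose_mat W' * W') $$ (i, j) = 1\<^sub>m (Suc n) $$ (i, j)" using ij by simp
  qed (auto simp: W'_def)
  then show ?thesis by (intro that[of W']) (auto simp: W'_def)
qed

lemma isometry_extends_orthogonal:
  fixes W :: "real mat"
  assumes "W \<in> carrier_mat N n" "transpose_mat W * W = 1\<^sub>m n"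
  shows "\<exists>Q. Q \<in> carrier_mat N N \<and> transpose_mat Q * Q = 1\<^sub>m N \<and> (\<forall>i<N. \<forall>j<n. Q $$ (i, j) = W $$ (i, j))"
  using assms
proof (induction "N - n" arbitrary: n W)
  case 0
  then have "n = N" using isometry_dim_le[OF 0(2,3)] by simp
  then show ?case using 0 by auto
next
  case (Suc k)
  then have "n < N" by simp
  from isometry_add_column[OF Suc(3,4) this] obtain W' where
    W': "W' \<in> carrier_mat N (Suc n)" "transpose_mat W' * W' = 1\<^sub>m (Suc n)"
    "\<And>i j. i < N \<Longrightarrow> j < n \<Longrightarrow> W' $$ (i, j) = W $$ (i, j)" by blast
  have "k = N - Suc n" using Suc(2) by simp
  from Suc(1)[OF this W'(1,2)] W'(3) show ?case by (metis less_SucI)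
qed

lemma index_mult_mat_sum:
  assumes "A \<in> carrier_mat r n" "B \<in> carrier_mat n c" "i < r" "j < c"
  shows "(A * B) $$ (i, j) = (\<Sum>l<n. A $$ (i, l) * B $$ (l, j))"
  using assms by (simp add: scalar_prod_def atLeast0LessThan)

lemma unitarily_equiv_conj_orthogonal:
  assumes "Y \<in> SM N" "Q \<in> carrier_mat N N" "transpose_mat Q * Q = 1\<^sub>m N"
  shows "unitarily_equiv (conj_tuple Q Y) Y"
proof -
  have QQ: "Q * transpose_mat Q = 1\<^sub>m N"
    using mat_mult_left_right_inverse[of "transpose_mat Q" N Q] assms(2,3) by simp
  have M: "conj_tuple Q Y k \<in> carrier_mat N N" for k
    using SM_carrier[OF conj_tuple_SM[OF assms(1,2)]] .
  have "conj_tuple (transpose_mat Q) (conj_tuple Q Y) k = Y k" for k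
  proof -
    note c = SM_carrier[OF assms(1), of k] assms(2)
    have "conj_tuple (transpose_mat Q) (conj_tuple Q Y) k = Q * (transpose_mat Q * (Y k * Q)) * transpose_mat Q"
      using c by (simp add: conj_tuple_def assoc_mult_mat[of "transpose_mat Q" N N "Y k" N Q N])
    also have "Q * (transpose_mat Q * (Y k * Q)) = (Q * transpose_mat Q) * (Y k * Q)"
      by (rule assoc_mult_mat[symmetric, of _ N N _ N _ N]) (use c in auto)
    also have "(Q * transpose_mat Q) * (Y k * Q) = Y k * Q" unfolding QQ using c by simp
    also have "Y k * Q * transpose_mat Q = Y k * (Q * transpose_mat Q)"
      by (rule assoc_mult_mat[of _ N N _ N _ N]) (use c in auto)
    also have "\<dots> = Y k" unfolding QQ using c by simp
    finally show ?thesis .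
  qed
  \<comment> \<open>The equivalence leads from the conjugated tuple back to \<open>Y\<close>, hence
    the transpose of \<open>Q\<close> as witness.\<close>
  then show ?thesis
    unfolding unitarily_equiv_def using M SM_carrier[OF assms(1)] QQ assms(2)
    by (intro exI[of _ N] exI[of _ "transpose_mat Q"]) auto
qed

lemma scalar_multiple_isometry:
  assumes V: "V \<in> carrier_mat N n" "V \<noteq> 0\<^sub>m N n" and c: "transpose_mat V * V = c \<cdot>\<^sub>m 1\<^sub>m n"
  shows "transpose_mat ((1 / sqrt c) \<cdot>\<^sub>m V) * ((1 / sqrt c) \<cdot>\<^sub>m V) = 1\<^sub>m n"
proof -
  have VV: "scalar_prod (col V i) (col V j) = (if i = j then c else 0)" if "i < n" "j < n" for i j
  proof -
    have "(transpose_mat V * V) $$ (i, j) = (if i = j then c else 0)" using that c by simp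
    then show ?thesis using that V(1) by simp
  qed
  obtain i j where ij: "i < N" "j < n" "V $$ (i, j) \<noteq> 0"
    using V by (metis carrier_matD eq_matI index_zero_mat)
  \<comment> \<open>The squared norm of a nonzero column is \<open>c\<close>, which makes
    \<open>c\<close> positive.\<close>
  have "col V j \<noteq> 0\<^sub>v N" using ij V(1) by (metis carrier_matD index_col index_zero_vec(1))
  then have "c > 0"
    using scalar_prod_self_eq_0_iff[of "col V j" N] scalar_prod_self_nonneg[of "col V j"] VV[OF ij(2,2)] V(1)
    by force
  then show ?thesis
    using V(1) VV by (intro eq_matI)
      (auto simp: smult_scalar_prod_distrib[of _ N] scalar_prod_smult_distrib[of _ N])
qed

text \<open>A Schur argument. \<open>X\<close> and \<open>Y\<close> are symmetric, so the transpose
  of \<open>V\<close> intertwines in the other direction, and the Gram matrix of \<open>V\<close>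
  commutes with \<open>X\<close> and is scalar. Once the rescaled \<open>V\<close> is completed to
  an orthogonal \<open>Q\<close>, conjugation by \<open>Q\<close> splits \<open>Y\<close>; the
  second block is a compression of \<open>Y\<close> and so stays in \<open>Wmax C\<close>.\<close>

lemma intertwiner_direct_summand:
  assumes X: "X \<in> SM n" "n \<ge> 1" and Y: "Y \<in> Wmax C" "Y \<in> SM N"
    and V: "V \<in> carrier_mat N n" "V \<noteq> 0\<^sub>m N n" and YV: "\<And>k. Y k * V = V * X k"
    and irred: "\<And>M. \<lbrakk>M \<in> carrier_mat n n; transpose_mat M = M; \<And>k. M * X k = X k * M\<rbrakk>
      \<Longrightarrow> \<exists>c. M = c \<cdot>\<^sub>m 1\<^sub>m n"
  shows "(N = n \<and> unitarily_equiv X Y) \<or> (n < N \<and> (\<exists>Z\<in>Wmax C. unitarily_equiv (direct_sum X Z) Y))"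
proof -
  note cX = SM_carrier[OF X(1)] and cY = SM_carrier[OF Y(2)]
  have "\<exists>c. transpose_mat V * V = c \<cdot>\<^sub>m 1\<^sub>m n"
  proof (rule irred)
    show "transpose_mat V * V \<in> carrier_mat n n" using V by auto
    show "transpose_mat (transpose_mat V * V) = transpose_mat V * V"
      using transpose_mult[of "transpose_mat V" n N V n] V by simp
    show "transpose_mat V * V * X k = X k * (transpose_mat V * V)" for k
    proof -
      have "transpose_mat (Y k * V) = transpose_mat V * Y k"
        using transpose_mult[OF cY V(1), of k] SM_transpose[OF Y(2), of k] by simp
      moreover have "transpose_mat (V * X k) = X k * transpose_mat V"
        using transpose_mult[OF V(1) cX, of k] SM_transpose[OF X(1), of k] by simp
      ultimately have T: "transpose_mat V * Y k = X k * transpose_mat V" using YV[of k] by simp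
      have "transpose_mat V * V * X k = transpose_mat V * (V * X k)"
        by (rule assoc_mult_mat[of _ n N _ n _ n]) (use V cX[of k] in auto)
      also have "\<dots> = transpose_mat V * Y k * V" unfolding YV[symmetric]
        by (rule assoc_mult_mat[symmetric, of _ n N _ N _ n]) (use V cY[of k] in auto)
      also have "\<dots> = X k * (transpose_mat V * V)" unfolding T
        by (rule assoc_mult_mat[of _ n n _ N _ n]) (use V cX[of k] in auto)
      finally show ?thesis .
    qed
  qed
  then obtain c where c: "transpose_mat V * V = c \<cdot>\<^sub>m 1\<^sub>m n" by blast
  define W where "W = (1 / sqrt c) \<cdot>\<^sub>m V"
  have W: "W \<in> carrier_mat N n" "transpose_mat W * W = 1\<^sub>m n"
    using V scalar_multiple_isometry[OF V c] by (simp_all add: W_def)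
  have YW: "Y k * W = W * X k" for k
    using mult_smult_distrib[OF cY V(1)] mult_smult_assoc_mat[OF V(1) cX] YV[of k] by (simp add: W_def)
  have le: "n \<le> N" using isometry_dim_le[OF W] .
  obtain Q where Q: "Q \<in> carrier_mat N N" "transpose_mat Q * Q = 1\<^sub>m N"
    and QW: "\<And>i j. i < N \<Longrightarrow> j < n \<Longrightarrow> Q $$ (i, j) = W $$ (i, j)"
    using isometry_extends_orthogonal[OF W] by blast
  have colQ: "col Q j = col W j" if "j < n" for j
    using QW that Q(1) W(1) le by (intro eq_vecI) auto
  have QQ: "scalar_prod (col Q i) (col Q j) = (if i = j then 1 else 0)" if "i < N" "j < N" for i j
  proof -
    have "(transpose_mat Q * Q) $$ (i, j) = (if i = j then 1 else 0)" using that Q(2) by simp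
    then show ?thesis using that Q(1) by simp
  qed
  have entry: "conj_tuple Q Y k $$ (i, j) = scalar_prod (col Q i) (Y k *\<^sub>v col Q j)"
    if "i < N" "j < N" for i j k
  proof -
    have "conj_tuple Q Y k = transpose_mat Q * (Y k * Q)"
      unfolding conj_tuple_def by (rule assoc_mult_mat[of _ N N _ N _ N]) (use Q cY[of k] in auto)
    then show ?thesis using that Q(1) cY[of k] by simp
  qed
  \<comment> \<open>\<open>Y W = W X\<close> moves \<open>Y\<close> past the first \<open>n\<close>
    columns of \<open>Q\<close>; orthogonality to the other columns then leaves \<open>X\<close> on
    top and zero below.\<close>
  have left: "conj_tuple Q Y k $$ (i, j) = (if i < n then X k $$ (i, j) else 0)" if "i < N" "j < n" for i j k
  proof -
    have j: "j < N" using that le by simp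
    have "Y k *\<^sub>v col Q j = col (Y k * W) j"
      using cY[of k] W(1) that by (simp add: colQ)
    also have "\<dots> = col (W * X k) j" using YW by simp
    finally have "conj_tuple Q Y k $$ (i, j) = (transpose_mat Q * (W * X k)) $$ (i, j)"
      using entry[OF that(1) j] that Q(1) W(1) cX[of k] by simp
    also have "transpose_mat Q * (W * X k) = transpose_mat Q * W * X k"
      by (rule assoc_mult_mat[symmetric, of _ N N _ n _ n]) (use Q W cX[of k] in auto)
    also have "\<dots> $$ (i, j) = (\<Sum>l<n. (transpose_mat Q * W) $$ (i, l) * X k $$ (l, j))"
      by (rule index_mult_mat_sum[of _ N n _ n]) (use that Q(1) W(1) cX[of k] in auto)
    also have "\<dots> = (\<Sum>l<n. if l = i then X k $$ (l, j) else 0)"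
    proof (rule sum.cong)
      fix l assume l: "l \<in> {..<n}"
      then have "(transpose_mat Q * W) $$ (i, l) = (if i = l then 1 else 0)"
        using that Q(1) W(1) QQ[of i l] le by (simp add: colQ)
      then show "(transpose_mat Q * W) $$ (i, l) * X k $$ (l, j) = (if l = i then X k $$ (l, j) else 0)" by simp
    qed simp
    also have "\<dots> = (if i < n then X k $$ (i, j) else 0)" by (simp add: sum.delta)
    finally show ?thesis .
  qed
  have M: "conj_tuple Q Y \<in> SM N" by (rule conj_tuple_SM[OF Y(2) Q(1)])
  note equiv = unitarily_equiv_conj_orthogonal[OF Y(2) Q]
  show ?thesis
  proof (cases "N = n")
    case True
    then have "conj_tuple Q Y = X"
      using left carrier_matD[OF cX] carrier_matD[OF SM_carrier[OF M]] by (intro ext eq_matI) auto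
    then show ?thesis using equiv True by simp
  next
    case False
    then have lt: "n < N" using le by simp
    \<comment> \<open>The remaining columns of \<open>Q\<close>: compression by \<open>R\<close> is
      the complementary summand.\<close>
    define R where "R = mat N (N - n) (\<lambda>(i, j). Q $$ (i, j + n))"
    have R: "R \<in> carrier_mat N (N - n)" by (simp add: R_def)
    have colR: "col R j = col Q (j + n)" if "j < N - n" for j
      using that Q(1) by (intro eq_vecI) (auto simp: R_def)
    have RR: "transpose_mat R * R = 1\<^sub>m (N - n)"
      using R QQ by (intro eq_matI) (auto simp: colR)
    have Z: "conj_tuple R Y \<in> Wmax C"
      using Wmax_compression[OF Y R RR] lt by simp
    have cZ: "conj_tuple R Y k \<in> carrier_mat (N - n) (N - n)" for k
      using SM_carrier[OF conj_tuple_SM[OF Y(2) R]] .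
    have entryR: "conj_tuple R Y k $$ (i, j) = scalar_prod (col R i) (Y k *\<^sub>v col R j)"
      if "i < N - n" "j < N - n" for i j k
    proof -
      have "conj_tuple R Y k = transpose_mat R * (Y k * R)"
        unfolding conj_tuple_def by (rule assoc_mult_mat[of _ "N - n" N _ N _ "N - n"]) (use R cY[of k] in auto)
      then show ?thesis using that R cY[of k] by simp
    qed
    have "direct_sum X (conj_tuple R Y) = conj_tuple Q Y"
    proof (rule ext, rule eq_matI)
      fix k i j assume "i < dim_row (conj_tuple Q Y k)" "j < dim_col (conj_tuple Q Y k)"
      then have ij: "i < N" "j < N" using SM_carrier[OF M, of k] by auto
      have "direct_sum X (conj_tuple R Y) k $$ (i, j) =
          (if i < n then if j < n then X k $$ (i, j) else 0
           else if j < n then 0 else conj_tuple R Y k $$ (i - n, j - n))"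
        using ij lt cX[of k] cZ[of k] by (auto simp: direct_sum_def Let_def)
      also have "\<dots> = conj_tuple Q Y k $$ (i, j)"
      proof (cases "j < n")
        case True
        then show ?thesis using left[OF ij(1) True] by simp
      next
        case j: False
        show ?thesis
        proof (cases "i < n")
          case True
          \<comment> \<open>The upper right block is the transpose of the lower left one, which is
            already known to vanish.\<close>
          then show ?thesis using j left[OF ij(2) True, of k] SM_sym[OF M ij, of k] by simp
        next
          case False
          then have "i - n < N - n" "j - n < N - n" using j ij by auto
          then show ?thesis using j False by (simp add: entryR entry[OF ij] colR)
        qed
      qed
      finally show "direct_sum X (conj_tuple R Y) k $$ (i, j) = conj_tuple Q Y k $$ (i, j)" .
    next
      fix k
      show "dim_row (direct_sum X (conj_tuple R Y) k) = dim_row (conj_tuple Q Y k)"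
        "dim_col (direct_sum X (conj_tuple R Y) k) = dim_col (conj_tuple Q Y k)"
        using lt cX[of k] cZ[of k] SM_carrier[OF M, of k] by (auto simp: direct_sum_def Let_def)
    qed
    then show ?thesis using equiv lt Z by metis
  qed
qed

text \<open>If \<open>X\<close> is a matrix convex combination of the \<open>Y\<^sub>l\<close>, then \<open>V\<^sub>l\<close> maps the kernel of every
  positive semidefinite pencil at \<open>X\<close> into the kernel of the same pencil at \<open>Y\<^sub>l\<close>; when these kernel
  conditions force \<open>Y\<^sub>l V\<^sub>l = V\<^sub>l X\<close>, irreducibility of \<open>X\<close> makes \<open>V\<^sub>l\<close> a multiple of an isometry onto a
  reducing subspace of \<open>Y\<^sub>l\<close>.\<close>

lemma free_extreme_WmaxI:
  assumes X: "X \<in> Wmax C" "X \<in> SM n" "n \<ge> 1"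
    and rigid: "\<And>N Y V. \<lbrakk>Y \<in> SM N; V \<in> carrier_mat N n;
        \<And>a0 a u. \<lbrakk>\<forall>x\<in>C. 0 \<le> a0 + (\<Sum>k\<in>UNIV. a k * vec_nth x k); u \<in> carrier_vec n;
          pencil n a0 a X *\<^sub>v u = 0\<^sub>v n\<rbrakk> \<Longrightarrow> pencil N a0 a Y *\<^sub>v (V *\<^sub>v u) = 0\<^sub>v N\<rbrakk>
      \<Longrightarrow> \<forall>k. Y k * V = V * X k"
    and irred: "\<And>M. \<lbrakk>M \<in> carrier_mat n n; transpose_mat M = M; \<And>k. M * X k = X k * M\<rbrakk>
      \<Longrightarrow> \<exists>c. M = c \<cdot>\<^sub>m 1\<^sub>m n"
  shows "X \<in> free_extreme (Wmax C)"
proof -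
  have "(N l = n \<and> unitarily_equiv X (Y l)) \<or>
      (n < N l \<and> (\<exists>Z\<in>Wmax C. unitarily_equiv (direct_sum X Z) (Y l)))"
    if comb: "matrix_convex_comb (Wmax C) n X m N V Y" and nz: "\<forall>l<m. V l \<noteq> 0\<^sub>m (N l) n" and l: "l < m"
    for m N V Y l
  proof -
    note D = matrix_convex_combD[OF comb l]
    have "\<forall>k. Y l k * V l = V l * X k"
      by (rule rigid[OF D(2,3)]) (rule pencil_kernel_comb[OF comb X(2) _ _ _ l])
    then show ?thesis
      using nz l by (intro intertwiner_direct_summand[OF X(2,3) D _ _ irred]) auto
  qed
  then show ?thesis using X unfolding free_extreme_def level_def by blast
qed

section \<open>Matrix pairs with elliptical numerical range\<close>

lemma linear_form_two_zeros:
  fixes c0 c1 :: real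
  assumes "c0 * x + c1 * y = 0" "c0 * x' + c1 * y' = 0" "x * y' \<noteq> x' * y"
  shows "c0 = 0 \<and> c1 = 0"
proof -
  have "c0 * (x * y' - x' * y) = y' * (c0 * x + c1 * y) - y * (c0 * x' + c1 * y')"
    "c1 * (x * y' - x' * y) = x * (c0 * x' + c1 * y') - x' * (c0 * x + c1 * y)"
    by (simp_all add: algebra_simps)
  then show ?thesis unfolding assms(1,2) using assms(3) by simp
qed

text \<open>The pairs \<open>(x i, y i)\<close> represent distinct points of the projective line. A
  zero at index 2 splits off the linear factor \<open>x * y 2 - x 2 * y\<close>; \<open>d0\<close>
  and \<open>d1\<close> are the coefficients of the quotient, which still vanishes at the other two
  points.\<close>

lemma quadratic_form_three_zeros:
  fixes c0 c1 c2 :: real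
  assumes "\<And>i. i < (3::nat) \<Longrightarrow> c0 * x i ^ 2 + c1 * x i * y i + c2 * y i ^ 2 = 0"
    and "\<And>i j. i < 3 \<Longrightarrow> j < 3 \<Longrightarrow> i \<noteq> j \<Longrightarrow> x i * y j \<noteq> x j * y i"
  shows "c0 = 0 \<and> c1 = 0 \<and> c2 = 0"
proof -
  have ne: "x 2 \<noteq> 0 \<or> y 2 \<noteq> 0" using assms(2)[of 0 2] by auto
  have z: "c0 * x 2 ^ 2 + c1 * x 2 * y 2 + c2 * y 2 ^ 2 = 0" using assms(1) by simp
  obtain d0 d1 where d: "c0 = y 2 * d0" "c1 = y 2 * d1 - x 2 * d0" "c2 = - x 2 * d1"
  proof (cases "y 2 = 0")
    case True
    then show ?thesis using ne z that[of "- c1 / x 2" "- c2 / x 2"] by simp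
  next
    case False
    define d0 where "d0 = c0 / y 2"
    define d1 where "d1 = (c1 + x 2 * d0) / y 2"
    have c: "c0 = y 2 * d0" "c1 = y 2 * d1 - x 2 * d0" using False by (simp_all add: d0_def d1_def)
    have "c0 * x 2 ^ 2 + c1 * x 2 * y 2 + c2 * y 2 ^ 2 = (c2 + x 2 * d1) * y 2 ^ 2"
      unfolding c by (simp add: algebra_simps power2_eq_square)
    then have "c2 = - x 2 * d1" using z False by (simp add: add_eq_0_iff)
    with c show ?thesis by (rule that)
  qed
  have "d0 * x i + d1 * y i = 0" if "i < 2" for i
  proof -
    have "(x i * y 2 - x 2 * y i) * (d0 * x i + d1 * y i) = c0 * x i ^ 2 + c1 * x i * y i + c2 * y i ^ 2"
      unfolding d by (simp add: algebra_simps power2_eq_square)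
    then show ?thesis using assms(1)[of i] assms(2)[of i 2] that by simp
  qed
  then have "d0 = 0 \<and> d1 = 0"
    using linear_form_two_zeros[of d0 "x 0" d1 "y 0" "x 1" "y 1"] assms(2)[of 0 1] by auto
  then show ?thesis using d by simp
qed

lemma cubic_form_four_zeros:
  fixes c0 c1 c2 c3 :: real
  assumes "\<And>i. i < (4::nat) \<Longrightarrow> c0 * x i ^ 3 + c1 * x i ^ 2 * y i + c2 * x i * y i ^ 2 + c3 * y i ^ 3 = 0"
    and "\<And>i j. i < 4 \<Longrightarrow> j < 4 \<Longrightarrow> i \<noteq> j \<Longrightarrow> x i * y j \<noteq> x j * y i"
  shows "c0 = 0 \<and> c1 = 0 \<and> c2 = 0 \<and> c3 = 0"
proof -
  have ne: "x 3 \<noteq> 0 \<or> y 3 \<noteq> 0" using assms(2)[of 0 3] by auto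
  have z: "c0 * x 3 ^ 3 + c1 * x 3 ^ 2 * y 3 + c2 * x 3 * y 3 ^ 2 + c3 * y 3 ^ 3 = 0" using assms(1) by simp
  obtain d0 d1 d2 where d: "c0 = y 3 * d0" "c1 = y 3 * d1 - x 3 * d0" "c2 = y 3 * d2 - x 3 * d1" "c3 = - x 3 * d2"
  proof (cases "y 3 = 0")
    case True
    then show ?thesis using ne z that[of "- c1 / x 3" "- c2 / x 3" "- c3 / x 3"] by simp
  next
    case False
    define d0 where "d0 = c0 / y 3"
    define d1 where "d1 = (c1 + x 3 * d0) / y 3"
    define d2 where "d2 = (c2 + x 3 * d1) / y 3"
    have c: "c0 = y 3 * d0" "c1 = y 3 * d1 - x 3 * d0" "c2 = y 3 * d2 - x 3 * d1"
      using False by (simp_all add: d0_def d1_def d2_def)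
    have "c0 * x 3 ^ 3 + c1 * x 3 ^ 2 * y 3 + c2 * x 3 * y 3 ^ 2 + c3 * y 3 ^ 3 = (c3 + x 3 * d2) * y 3 ^ 3"
      unfolding c by (simp add: algebra_simps power2_eq_square power3_eq_cube)
    then have "c3 = - x 3 * d2" using z False by (simp add: add_eq_0_iff)
    with c show ?thesis by (rule that)
  qed
  have "d0 * x i ^ 2 + d1 * x i * y i + d2 * y i ^ 2 = 0" if "i < 3" for i
  proof -
    have "(x i * y 3 - x 3 * y i) * (d0 * x i ^ 2 + d1 * x i * y i + d2 * y i ^ 2)
        = c0 * x i ^ 3 + c1 * x i ^ 2 * y i + c2 * x i * y i ^ 2 + c3 * y i ^ 3"
      unfolding d by (simp add: algebra_simps power2_eq_square power3_eq_cube)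
    then show ?thesis using assms(1)[of i] assms(2)[of i 3] that by simp
  qed
  then have "d0 = 0 \<and> d1 = 0 \<and> d2 = 0"
    using assms(2) by (intro quadratic_form_three_zeros[of d0 x d1 y d2]) auto
  then show ?thesis using d by simp
qed

text \<open>The matrix with rows \<open>(\<alpha> + \<beta>, \<gamma>)\<close> and
  \<open>(\<gamma>, \<alpha> - \<beta>)\<close> is singular, and \<open>(x, y)\<close> spans its
  kernel. If \<open>- \<beta> / \<alpha>\<close> and \<open>- \<gamma> / \<alpha>\<close> are cosine
  and sine of \<open>t\<close>, the kernel vector has angle \<open>t / 2\<close>.\<close>

lemma half_angle:
  fixes \<alpha> \<beta> \<gamma> :: real
  assumes "\<alpha> > 0" "\<alpha>\<^sup>2 = \<beta>\<^sup>2 + \<gamma>\<^sup>2"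
  obtains x y where "x\<^sup>2 + y\<^sup>2 = 1" "\<beta> = - \<alpha> * (x\<^sup>2 - y\<^sup>2)" "\<gamma> = - \<alpha> * (2 * x * y)"
proof -
  have "(- \<beta> / \<alpha>)\<^sup>2 + (- \<gamma> / \<alpha>)\<^sup>2 = (\<beta>\<^sup>2 + \<gamma>\<^sup>2) / \<alpha>\<^sup>2"
    by (simp add: power_divide add_divide_distrib)
  also have "\<dots> = 1" unfolding assms(2)[symmetric] using assms(1) by simp
  finally have "(- \<beta> / \<alpha>)\<^sup>2 + (- \<gamma> / \<alpha>)\<^sup>2 = 1" .
  then obtain t where t: "- \<beta> / \<alpha> = cos t" "- \<gamma> / \<alpha> = sin t" by (metis sincos_total_2pi)
  have "cos t = (cos (t / 2))\<^sup>2 - (sin (t / 2))\<^sup>2" "sin t = 2 * cos (t / 2) * sin (t / 2)"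
    using cos_double[of "t / 2"] sin_double[of "t / 2"] by simp_all
  with t assms(1) show ?thesis
    by (intro that[of "cos (t / 2)" "sin (t / 2)"]) (auto simp: field_simps)
qed

section \<open>The matrix pair of an ellipse\<close>

definition ellipse_tuple :: "real ^ 'g \<Rightarrow> real ^ 'g \<Rightarrow> real ^ 'g \<Rightarrow> ('g::finite) mat_tuple" where
  "ellipse_tuple c p q = (\<lambda>k. mat 2 2 (\<lambda>(i, j). if i \<noteq> j then vec_nth q k
    else if i = 0 then vec_nth c k + vec_nth p k else vec_nth c k - vec_nth p k))"

lemma ellipse_tuple_SM: "ellipse_tuple c p q \<in> SM 2"
  by (auto simp: SM_def ellipse_tuple_def intro!: eq_matI)

lemma less_2_nat: "i < 2 \<longleftrightarrow> i = 0 \<or> i = Suc 0" for i :: nat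
  by auto

lemma scalar_prod_carrier_vec_2:
  "w \<in> carrier_vec 2 \<Longrightarrow> scalar_prod u w = vec_index u 0 * vec_index w 0 + vec_index u 1 * vec_index w 1"
  by (simp add: scalar_prod_def numeral_2_eq_2)

lemma ellipse_tuple_mult_vec:
  assumes "u \<in> carrier_vec 2"
  shows "vec_index (ellipse_tuple c p q k *\<^sub>v u) 0
      = (vec_nth c k + vec_nth p k) * vec_index u 0 + vec_nth q k * vec_index u 1"
    and "vec_index (ellipse_tuple c p q k *\<^sub>v u) 1
      = vec_nth q k * vec_index u 0 + (vec_nth c k - vec_nth p k) * vec_index u 1"
  using assms by (auto simp: ellipse_tuple_def scalar_prod_def numeral_2_eq_2)

lemma pencil_ellipse_tuple_mult_vec:
  fixes c p q :: "real ^ 'g::finite" and a :: "'g \<Rightarrow> real" and a0 :: real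
  assumes u: "u \<in> carrier_vec 2"
  defines "\<alpha> \<equiv> a0 + inner (\<chi> k. a k) c" and "\<beta> \<equiv> inner (\<chi> k. a k) p" and "\<gamma> \<equiv> inner (\<chi> k. a k) q"
  shows "vec_index (pencil 2 a0 a (ellipse_tuple c p q) *\<^sub>v u) 0 = (\<alpha> + \<beta>) * vec_index u 0 + \<gamma> * vec_index u 1"
    and "vec_index (pencil 2 a0 a (ellipse_tuple c p q) *\<^sub>v u) 1 = \<gamma> * vec_index u 0 + (\<alpha> - \<beta>) * vec_index u 1"
proof -
  have "vec_index (pencil 2 a0 a (ellipse_tuple c p q) *\<^sub>v u) 0 = a0 * vec_index u 0
      + (\<Sum>k\<in>UNIV. a k * ((vec_nth c k + vec_nth p k) * vec_index u 0 + vec_nth q k * vec_index u 1))"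
    unfolding ellipse_tuple_mult_vec(1)[OF u, symmetric] by (rule pencil_mult_vec[OF ellipse_tuple_SM u]) simp
  also have "\<dots> = (\<alpha> + \<beta>) * vec_index u 0 + \<gamma> * vec_index u 1"
    by (simp add: \<alpha>_def \<beta>_def \<gamma>_def inner_vec_def algebra_simps sum.distrib sum_distrib_left)
  finally show "vec_index (pencil 2 a0 a (ellipse_tuple c p q) *\<^sub>v u) 0
      = (\<alpha> + \<beta>) * vec_index u 0 + \<gamma> * vec_index u 1" .
  have "vec_index (pencil 2 a0 a (ellipse_tuple c p q) *\<^sub>v u) 1 = a0 * vec_index u 1
      + (\<Sum>k\<in>UNIV. a k * (vec_nth q k * vec_index u 0 + (vec_nth c k - vec_nth p k) * vec_index u 1))"
    unfolding ellipse_tuple_mult_vec(2)[OF u, symmetric] by (rule pencil_mult_vec[OF ellipse_tuple_SM u]) simp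
  also have "\<dots> = \<gamma> * vec_index u 0 + (\<alpha> - \<beta>) * vec_index u 1"
    by (simp add: \<alpha>_def \<beta>_def \<gamma>_def inner_vec_def algebra_simps sum.distrib sum_distrib_left sum_subtractf)
  finally show "vec_index (pencil 2 a0 a (ellipse_tuple c p q) *\<^sub>v u) 1
      = \<gamma> * vec_index u 0 + (\<alpha> - \<beta>) * vec_index u 1" .
qed

text \<open>At a nonzero vector \<open>(x, y)\<close> of squared length \<open>r\<close>, the form
  of the pencil is \<open>r\<close> times the affine form at the point of the curve with coordinates
  \<open>(x^2 - y^2) / r\<close> along \<open>p\<close> and \<open>2 * x * y / r\<close> along
  \<open>q\<close>. So positivity on \<open>C\<close> is inherited.\<close>

lemma ellipse_tuple_Wmax:
  fixes c p q :: "real ^ 'g::finite"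
  assumes "\<And>\<xi> \<eta>. \<xi>\<^sup>2 + \<eta>\<^sup>2 = 1 \<Longrightarrow> c + \<xi> *\<^sub>R p + \<eta> *\<^sub>R q \<in> C"
  shows "ellipse_tuple c p q \<in> Wmax C"
proof (rule Wmax_I[OF ellipse_tuple_SM])
  fix a0 and a :: "'g \<Rightarrow> real" and u :: "real vec"
  assume C: "\<forall>x\<in>C. 0 \<le> a0 + (\<Sum>k\<in>UNIV. a k * vec_nth x k)" and u: "u \<in> carrier_vec 2"
  define x y where "x = vec_index u 0" and "y = vec_index u 1"
  define A where "A = (\<chi> k. a k)"
  have C': "0 \<le> a0 + inner A z" if "z \<in> C" for z using C that by (simp add: inner_vec_def A_def)
  have "scalar_prod u (pencil 2 a0 a (ellipse_tuple c p q) *\<^sub>v u)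
      = x * vec_index (pencil 2 a0 a (ellipse_tuple c p q) *\<^sub>v u) 0 + y * vec_index (pencil 2 a0 a (ellipse_tuple c p q) *\<^sub>v u) 1"
    unfolding x_def y_def by (rule scalar_prod_carrier_vec_2) (rule mult_mat_vec_carrier[OF pencil_carrier u])
  also have "\<dots> = (x\<^sup>2 + y\<^sup>2) * (a0 + inner A c) + (x\<^sup>2 - y\<^sup>2) * inner A p + 2 * x * y * inner A q"
    unfolding pencil_ellipse_tuple_mult_vec[OF u] A_def[symmetric] x_def[symmetric] y_def[symmetric]
    by (simp add: algebra_simps power2_eq_square)
  also have "\<dots> \<ge> 0"
  proof (cases "x = 0 \<and> y = 0")
    case False
    define r where "r = x\<^sup>2 + y\<^sup>2"
    have r: "r > 0" using False by (simp add: r_def sum_power2_gt_zero_iff)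
    have "(x\<^sup>2 - y\<^sup>2)\<^sup>2 + (2 * x * y)\<^sup>2 = r\<^sup>2" by (simp add: r_def algebra_simps power2_eq_square)
    then have "((x\<^sup>2 - y\<^sup>2) / r)\<^sup>2 + (2 * x * y / r)\<^sup>2 = 1"
      using r by (simp add: power_divide add_divide_distrib[symmetric])
    from C'[OF assms[OF this]]
    have "0 \<le> r * (a0 + inner A (c + ((x\<^sup>2 - y\<^sup>2) / r) *\<^sub>R p + (2 * x * y / r) *\<^sub>R q))" using r by simp
    also have "\<dots> = r * (a0 + inner A c) + (x\<^sup>2 - y\<^sup>2) * inner A p + 2 * x * y * inner A q"
      using r by (simp add: inner_add_right distrib_left)
    finally show ?thesis by (simp add: r_def)
  qed simp
  finally show "0 \<le> scalar_prod u (pencil 2 a0 a (ellipse_tuple c p q) *\<^sub>v u)" .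
qed simp

text \<open>Apply \<open>V\<close> to the kernel equation at \<open>X\<close> and subtract it from
  the one at \<open>Y\<close>. The constant terms cancel, and a linear equation for row
  \<open>r\<close> of \<open>Y V - V X\<close> remains.\<close>

lemma pencil_kernel_difference:
  assumes X: "X \<in> SM n" and Y: "Y \<in> SM N" and V: "V \<in> carrier_mat N n" and u: "u \<in> carrier_vec n"
    and kX: "pencil n a0 a X *\<^sub>v u = 0\<^sub>v n" and kY: "pencil N a0 a Y *\<^sub>v (V *\<^sub>v u) = 0\<^sub>v N" and r: "r < N"
  shows "(\<Sum>k\<in>UNIV. a k * (\<Sum>j<n. ((Y k * V) $$ (r, j) - (V * X k) $$ (r, j)) * vec_index u j)) = 0"
proof -
  have mv: "vec_index (A *\<^sub>v u) r = (\<Sum>j<n. A $$ (r, j) * vec_index u j)" if "A \<in> carrier_mat N n" for A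
    using that u r by (simp add: scalar_prod_def atLeast0LessThan)
  have YV: "Y k * V \<in> carrier_mat N n" and VX: "V * X k \<in> carrier_mat N n" for k
    using SM_carrier[OF X, of k] SM_carrier[OF Y, of k] V by auto
  have Vu: "V *\<^sub>v u \<in> carrier_vec N" using V u by simp
  have e1: "vec_index (Y k *\<^sub>v (V *\<^sub>v u)) r = (\<Sum>j<n. (Y k * V) $$ (r, j) * vec_index u j)" for k
    unfolding mv[OF YV, symmetric] assoc_mult_mat_vec[OF SM_carrier[OF Y] V u] ..
  have eY: "0 = a0 * vec_index (V *\<^sub>v u) r + (\<Sum>k\<in>UNIV. a k * (\<Sum>j<n. (Y k * V) $$ (r, j) * vec_index u j))"
    unfolding e1[symmetric] pencil_mult_vec[OF Y Vu r, symmetric] kY using r by simp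
  have Xu: "vec_index (X k *\<^sub>v u) i = (\<Sum>j<n. X k $$ (i, j) * vec_index u j)" if "i < n" for i k
    using that SM_carrier[OF X, of k] u by (simp add: scalar_prod_def atLeast0LessThan)
  have e2: "(\<Sum>i<n. V $$ (r, i) * vec_index (X k *\<^sub>v u) i) = (\<Sum>j<n. (V * X k) $$ (r, j) * vec_index u j)" for k
  proof -
    have "(\<Sum>j<n. (V * X k) $$ (r, j) * vec_index u j) = vec_index (V *\<^sub>v (X k *\<^sub>v u)) r"
      unfolding mv[OF VX, symmetric] assoc_mult_mat_vec[OF V SM_carrier[OF X] u] ..
    also have "\<dots> = (\<Sum>i<n. V $$ (r, i) * vec_index (X k *\<^sub>v u) i)"
      using V r SM_carrier[OF X, of k] by (simp add: scalar_prod_def[of "row V r"] atLeast0LessThan)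
    finally show ?thesis by simp
  qed
  have "0 = (\<Sum>i<n. V $$ (r, i) * vec_index (pencil n a0 a X *\<^sub>v u) i)" unfolding kX by simp
  also have "\<dots> = (\<Sum>i<n. V $$ (r, i) * (a0 * vec_index u i + (\<Sum>k\<in>UNIV. a k * vec_index (X k *\<^sub>v u) i)))"
    by (intro sum.cong refl) (simp only: pencil_mult_vec[OF X u] lessThan_iff)
  also have "\<dots> = a0 * (\<Sum>i<n. V $$ (r, i) * vec_index u i)
      + (\<Sum>i<n. \<Sum>k\<in>UNIV. a k * (V $$ (r, i) * vec_index (X k *\<^sub>v u) i))"
    by (simp only: distrib_left sum.distrib sum_distrib_left mult.left_commute)
  also have "\<dots> = a0 * vec_index (V *\<^sub>v u) r + (\<Sum>k\<in>UNIV. a k * (\<Sum>i<n. V $$ (r, i) * vec_index (X k *\<^sub>v u) i))"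
    unfolding mv[OF V] sum.swap[of _ UNIV] by (simp only: sum_distrib_left)
  finally have "0 = a0 * vec_index (V *\<^sub>v u) r
      + (\<Sum>k\<in>UNIV. a k * (\<Sum>j<n. (V * X k) $$ (r, j) * vec_index u j))" unfolding e2 .
  with eY show ?thesis
    by (simp add: left_diff_distrib sum_subtractf right_diff_distrib)
qed

lemma sum_lessThan_2: "(\<Sum>j<2. f j) = f 0 + f (1::nat)" for f :: "nat \<Rightarrow> 'a::comm_monoid_add"
  by (simp add: numeral_2_eq_2)

lemma plane_basis_coordinates:
  fixes p q d :: "real ^ 2"
  assumes "vec_nth p 1 * vec_nth q 2 \<noteq> vec_nth p 2 * vec_nth q 1"
  obtains x y where "d = x *\<^sub>R p + y *\<^sub>R q"
proof -
  let ?D = "vec_nth p 1 * vec_nth q 2 - vec_nth p 2 * vec_nth q 1"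
  let ?x = "(vec_nth d 1 * vec_nth q 2 - vec_nth d 2 * vec_nth q 1) / ?D"
  let ?y = "(vec_nth p 1 * vec_nth d 2 - vec_nth p 2 * vec_nth d 1) / ?D"
  have D: "?D \<noteq> 0" using assms by simp
  have "vec_nth d 1 * ?D = (vec_nth d 1 * vec_nth q 2 - vec_nth d 2 * vec_nth q 1) * vec_nth p 1
      + (vec_nth p 1 * vec_nth d 2 - vec_nth p 2 * vec_nth d 1) * vec_nth q 1"
    "vec_nth d 2 * ?D = (vec_nth d 1 * vec_nth q 2 - vec_nth d 2 * vec_nth q 1) * vec_nth p 2
      + (vec_nth p 1 * vec_nth d 2 - vec_nth p 2 * vec_nth d 1) * vec_nth q 2"
    by (simp_all add: algebra_simps)
  then have "vec_nth d 1 = ?x * vec_nth p 1 + ?y * vec_nth q 1" "vec_nth d 2 = ?x * vec_nth p 2 + ?y * vec_nth q 2"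
    using D by (simp_all add: nonzero_eq_divide_eq[OF D] add_divide_distrib[symmetric])
  then have "d = ?x *\<^sub>R p + ?y *\<^sub>R q"
    by (simp add: Finite_Cartesian_Product.vec_eq_iff forall_2)
  then show ?thesis by (rule that)
qed

text \<open>A tangent line of the ellipse gives a singular pencil at \<open>X\<close>, whose kernel vector \<open>u\<close> has half the
  polar angle of the normal. So the kernel conditions make each row of \<open>Y V - V X\<close> a cubic form in \<open>u\<close>
  that vanishes at the kernel vectors of the four tangent edges.\<close>

lemma ellipse_tuple_free_extreme:
  fixes C :: "(real ^ 2) set" and a :: "nat \<Rightarrow> real ^ 2" and b :: "nat \<Rightarrow> real"
  assumes inside: "\<And>\<xi> \<eta>. \<xi>\<^sup>2 + \<eta>\<^sup>2 = 1 \<Longrightarrow> c + \<xi> *\<^sub>R p + \<eta> *\<^sub>R q \<in> C"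
    and pq: "vec_nth p 1 * vec_nth q 2 \<noteq> vec_nth p 2 * vec_nth q 1"
    and nonneg: "\<And>i x. i < 4 \<Longrightarrow> x \<in> C \<Longrightarrow> 0 \<le> b i + inner (a i) x"
    and pos: "\<And>i. i < 4 \<Longrightarrow> 0 < b i + inner (a i) c"
    and tangent: "\<And>i. i < 4 \<Longrightarrow> (b i + inner (a i) c)\<^sup>2 = (inner (a i) p)\<^sup>2 + (inner (a i) q)\<^sup>2"
    and distinct: "\<And>i j. i < 4 \<Longrightarrow> j < 4 \<Longrightarrow> i \<noteq> j \<Longrightarrow>
      (b j + inner (a j) c) *\<^sub>R a i \<noteq> (b i + inner (a i) c) *\<^sub>R a j"
  shows "ellipse_tuple c p q \<in> free_extreme (Wmax C)"
proof (rule free_extreme_WmaxI[OF ellipse_tuple_Wmax[OF inside] ellipse_tuple_SM])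
  let ?X = "ellipse_tuple c p q"
  define \<alpha> where "\<alpha> i = b i + inner (a i) c" for i
  have "\<exists>x y. i < 4 \<longrightarrow> x\<^sup>2 + y\<^sup>2 = 1 \<and> inner (a i) p = - \<alpha> i * (x\<^sup>2 - y\<^sup>2) \<and> inner (a i) q = - \<alpha> i * (2 * x * y)" for i
    using half_angle[of "\<alpha> i" "inner (a i) p" "inner (a i) q"] pos[of i] tangent[of i] unfolding \<alpha>_def by metis
  then obtain x y where xy: "\<And>i. i < 4 \<Longrightarrow> (x i)\<^sup>2 + (y i)\<^sup>2 = 1"
    "\<And>i. i < 4 \<Longrightarrow> inner (a i) p = - \<alpha> i * ((x i)\<^sup>2 - (y i)\<^sup>2)"
    "\<And>i. i < 4 \<Longrightarrow> inner (a i) q = - \<alpha> i * (2 * x i * y i)" by metis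
  have \<alpha>: "\<alpha> i > 0" if "i < 4" for i using pos[OF that] by (simp add: \<alpha>_def)
  \<comment> \<open>Parallel unit kernel vectors agree up to sign, so their squares and products
    agree. The two normals, each divided by its value \<open>\<alpha>\<close> at the centre, then
    coincide on \<open>p\<close> and \<open>q\<close>, which span the plane, contrary to
    \<open>distinct\<close>.\<close>
  have indep: "x i * y j \<noteq> x j * y i" if "i < 4" "j < 4" "i \<noteq> j" for i j
  proof
    assume e: "x i * y j = x j * y i"
    have s: "(x i)\<^sup>2 * (y j)\<^sup>2 = (x j)\<^sup>2 * (y i)\<^sup>2" using e by (metis power_mult_distrib)
    have sq: "(x i)\<^sup>2 = (x j)\<^sup>2"
    proof -
      have "(x i)\<^sup>2 * (1 - (x j)\<^sup>2) = (x j)\<^sup>2 * (1 - (x i)\<^sup>2)"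
        using s xy(1)[OF that(1)] xy(1)[OF that(2)] by (metis add_diff_cancel_left')
      then show ?thesis by (simp add: algebra_simps)
    qed
    have "x i * y i * ((x j)\<^sup>2 + (y j)\<^sup>2) = x j * y j * ((x i)\<^sup>2 + (y i)\<^sup>2)"
    proof -
      have "x i * y i * ((x j)\<^sup>2 + (y j)\<^sup>2) = x i * x j * (x j * y i) + y i * y j * (x i * y j)"
        by (simp add: power2_eq_square algebra_simps)
      also have "\<dots> = x i * x j * (x i * y j) + y i * y j * (x j * y i)" using e by simp
      finally show ?thesis by (simp add: power2_eq_square algebra_simps)
    qed
    then have prod: "x i * y i = x j * y j" using xy(1) that by simp
    define z where "z = \<alpha> j *\<^sub>R a i - \<alpha> i *\<^sub>R a j"
    have "(y i)\<^sup>2 = (y j)\<^sup>2" using sq xy(1)[OF that(1)] xy(1)[OF that(2)] by linarith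
    then have "inner z p = 0" "inner z q = 0"
      using sq prod that by (simp_all add: z_def inner_diff_left xy mult.assoc)
    moreover obtain s t where "z = s *\<^sub>R p + t *\<^sub>R q" using plane_basis_coordinates[OF pq] .
    ultimately have "inner z z = 0" by (metis inner_add_right inner_scaleR_right mult_zero_right add_0)
    then show False using distinct[OF that] by (simp add: z_def \<alpha>_def)
  qed
  {
    fix N Y V
    assume Y: "Y \<in> SM N" and V: "V \<in> carrier_mat N 2"
      and ker: "\<And>a0 a u. \<lbrakk>\<forall>x\<in>C. 0 \<le> a0 + (\<Sum>k\<in>UNIV. a k * vec_nth x k); u \<in> carrier_vec 2;
          pencil 2 a0 a ?X *\<^sub>v u = 0\<^sub>v 2\<rbrakk> \<Longrightarrow> pencil N a0 a Y *\<^sub>v (V *\<^sub>v u) = 0\<^sub>v N"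
    have zero: "(\<chi> k. (Y k * V) $$ (r, 0) - (V * ?X k) $$ (r, 0)) = 0 \<and>
        (\<chi> k. (Y k * V) $$ (r, 1) - (V * ?X k) $$ (r, 1)) = (0 :: real ^ 2)" if r: "r < N" for r
    proof -
      define d where "d = (\<chi> k. (Y k * V) $$ (r, 0) - (V * ?X k) $$ (r, 0))"
      define e where "e = (\<chi> k. (Y k * V) $$ (r, 1) - (V * ?X k) $$ (r, 1))"
      have cond: "inner (a i) d * x i + inner (a i) e * y i = 0" if i: "i < 4" for i
      proof -
        define u where "u = vec 2 (\<lambda>l. if l = 0 then x i else y i)"
        have u: "u \<in> carrier_vec 2" "vec_index u 0 = x i" "vec_index u 1 = y i" by (simp_all add: u_def)
        have X0: "pencil 2 (b i) (vec_nth (a i)) ?X *\<^sub>v u = 0\<^sub>v 2"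
        proof (rule eq_vecI)
          fix l assume "l < dim_vec (0\<^sub>v 2 :: real vec)"
          then have "l = 0 \<or> l = 1" by auto
          moreover have "vec_index (pencil 2 (b i) (vec_nth (a i)) ?X *\<^sub>v u) 0 = \<alpha> i * x i * (1 - ((x i)\<^sup>2 + (y i)\<^sup>2))"
            unfolding pencil_ellipse_tuple_mult_vec[OF u(1)] u(2,3) vec_nth_inverse \<alpha>_def[symmetric] xy(2)[OF i] xy(3)[OF i]
            by (simp add: algebra_simps power2_eq_square)
          moreover have "vec_index (pencil 2 (b i) (vec_nth (a i)) ?X *\<^sub>v u) 1 = \<alpha> i * y i * (1 - ((x i)\<^sup>2 + (y i)\<^sup>2))"
            unfolding pencil_ellipse_tuple_mult_vec[OF u(1)] u(2,3) vec_nth_inverse \<alpha>_def[symmetric] xy(2)[OF i] xy(3)[OF i]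
            by (simp add: algebra_simps power2_eq_square)
          ultimately show "vec_index (pencil 2 (b i) (vec_nth (a i)) ?X *\<^sub>v u) l = vec_index (0\<^sub>v 2) l"
            unfolding xy(1)[OF i] by auto
        next
          show "dim_vec (pencil 2 (b i) (vec_nth (a i)) ?X *\<^sub>v u) = dim_vec (0\<^sub>v 2 :: real vec)"
            using mult_mat_vec_carrier[OF pencil_carrier u(1)] by (metis carrier_vecD zero_carrier_vec)
        qed
        have "\<forall>z\<in>C. 0 \<le> b i + (\<Sum>k\<in>UNIV. vec_nth (a i) k * vec_nth z k)"
          using nonneg[OF i] by (simp add: inner_vec_def)
        from pencil_kernel_difference[OF ellipse_tuple_SM Y V u(1) X0 ker[OF this u(1) X0] r]
        have "(\<Sum>k\<in>UNIV. vec_nth (a i) k * (vec_nth d k * x i + vec_nth e k * y i)) = 0"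
          unfolding sum_lessThan_2 u(2,3) d_def e_def by simp
        then show ?thesis
          by (simp add: inner_vec_def sum_distrib_right sum.distrib distrib_left mult.assoc)
      qed
      \<comment> \<open>In the basis \<open>p\<close>, \<open>q\<close> the products with
        \<open>a i\<close> become quadratic forms in \<open>(x i, y i)\<close>, so
        \<open>cond\<close> becomes cubic. Its four coefficients determine the four coordinates of
        \<open>d\<close> and \<open>e\<close>.\<close>
      obtain x0 y0 where d: "d = x0 *\<^sub>R p + y0 *\<^sub>R q" using plane_basis_coordinates[OF pq] .
      obtain x1 y1 where e: "e = x1 *\<^sub>R p + y1 *\<^sub>R q" using plane_basis_coordinates[OF pq] .
      have "x0 = 0 \<and> 2 * y0 + x1 = 0 \<and> 2 * y1 - x0 = 0 \<and> - x1 = 0"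
      proof (rule cubic_form_four_zeros[where x = x and y = y])
        fix i :: nat assume i: "i < 4"
        have "0 = - \<alpha> i * (x0 * x i ^ 3 + (2 * y0 + x1) * x i ^ 2 * y i + (2 * y1 - x0) * x i * y i ^ 2 + - x1 * y i ^ 3)"
          using cond[OF i] unfolding d e inner_add_right inner_scaleR_right xy(2)[OF i] xy(3)[OF i]
          by (simp add: algebra_simps power2_eq_square power3_eq_cube)
        then show "x0 * x i ^ 3 + (2 * y0 + x1) * x i ^ 2 * y i + (2 * y1 - x0) * x i * y i ^ 2 + - x1 * y i ^ 3 = 0"
          using \<alpha>[OF i] by simp
      qed (rule indep)
      then have "d = 0" "e = 0" using d e by simp_all
      then show ?thesis by (simp add: d_def e_def)
    qed
    show "\<forall>k. Y k * V = V * ?X k"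
    proof
      fix k
      note cX = SM_carrier[OF ellipse_tuple_SM, of c p q k] and cY = SM_carrier[OF Y, of k]
      show "Y k * V = V * ?X k"
      proof (rule eq_matI)
        fix r j assume "r < dim_row (V * ?X k)" "j < dim_col (V * ?X k)"
        then have r: "r < N" and j: "j = 0 \<or> j = 1" using V cX by auto
        have "(Y k * V) $$ (r, 0) - (V * ?X k) $$ (r, 0) = 0" "(Y k * V) $$ (r, 1) - (V * ?X k) $$ (r, 1) = 0"
          using zero[OF r] unfolding Finite_Cartesian_Product.vec_eq_iff by (simp_all only: vec_lambda_beta zero_index)
        then show "(Y k * V) $$ (r, j) = (V * ?X k) $$ (r, j)" using j by auto
      qed (use V cX cY in auto)
    qed
  }
  {
    fix M :: "real mat"
    assume M: "M \<in> carrier_mat 2 2" "transpose_mat M = M" and comm: "\<And>k. M * ?X k = ?X k * M"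
    define m n l where "m = M $$ (0, 0)" and "n = M $$ (0, 1)" and "l = M $$ (1, 1)"
    have n: "M $$ (1, 0) = n"
      using M by (metis carrier_matD index_transpose_mat(1) n_def one_less_numeral_iff semiring_norm(76) pos2)
    \<comment> \<open>The off-diagonal entry of the commutator relates \<open>p\<close> and
      \<open>q\<close> linearly; their independence makes \<open>M\<close> diagonal with equal
      entries.\<close>
    have "2 * n * vec_nth p k = (m - l) * vec_nth q k" for k
    proof -
      have "(M * ?X k) $$ (0, 1) = (?X k * M) $$ (0, 1)" using comm by simp
      moreover have "(M * ?X k) $$ (0, 1) = m * vec_nth q k + n * (vec_nth c k - vec_nth p k)"
        using index_mult_mat_sum[OF M(1) SM_carrier[OF ellipse_tuple_SM], of 0 1 c p q k]
        by (simp add: sum_lessThan_2 m_def n_def ellipse_tuple_def)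
      moreover have "(?X k * M) $$ (0, 1) = (vec_nth c k + vec_nth p k) * n + vec_nth q k * l"
        using index_mult_mat_sum[OF SM_carrier[OF ellipse_tuple_SM] M(1), of 0 1 c p q k]
        by (simp add: sum_lessThan_2 l_def n_def ellipse_tuple_def)
      ultimately show ?thesis by (simp add: algebra_simps)
    qed
    then have "2 * n * vec_nth p k + (l - m) * vec_nth q k = 0" for k
      by (simp add: left_diff_distrib)
    from this[of 1] this[of 2] have "2 * n = 0 \<and> l - m = 0"
      by (rule linear_form_two_zeros) (use pq in \<open>simp add: mult.commute\<close>)
    then have "M = m \<cdot>\<^sub>m 1\<^sub>m 2"
      using M(1) n by (intro eq_matI) (auto simp: less_2_nat m_def n_def l_def)
    then show "\<exists>s. M = s \<cdot>\<^sub>m 1\<^sub>m 2" by blast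
  }
qed simp_all

section \<open>Ellipses degenerating to a diagonal\<close>

text \<open>The ellipse is given by its centre \<open>(s, t)\<close> and the symmetric matrix \<open>Q\<close> with
  \<open>Q = p p\<^sup>T + q q\<^sup>T\<close>; tangency to a line is linear in \<open>Q\<close> for given \<open>(s, t)\<close>. The ellipses tangent to the
  four lines form a one-parameter family, here parametrised so that the segment is at parameter \<open>\<kappa> = 0\<close>.\<close>

lemma tangent_ellipses_degenerate:
  fixes \<alpha>1 \<alpha>2 \<gamma>1 \<gamma>2 :: real
  obtains s t p1 p2 q2 :: "nat \<Rightarrow> real" where
    "s \<longlonglongrightarrow> 1/2" "t \<longlonglongrightarrow> 0" "p1 \<longlonglongrightarrow> 1/2" "p2 \<longlonglongrightarrow> 0" "q2 \<longlonglongrightarrow> 0"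
    "\<forall>j. p1 j > 0" "\<forall>j. q2 j > 0"
    "\<forall>j. \<forall>a\<in>{\<alpha>1, \<alpha>2}. (s j + t j * a)\<^sup>2 = (p1 j + p2 j * a)\<^sup>2 + (q2 j * a)\<^sup>2"
    "\<forall>j. \<forall>c\<in>{\<gamma>1, \<gamma>2}. (1 - s j + t j * c)\<^sup>2 = (- p1 j + p2 j * c)\<^sup>2 + (q2 j * c)\<^sup>2"
proof -
  define \<kappa> where "\<kappa> j = 1 / real (Suc j)" for j
  \<comment> \<open>For a normal \<open>(1, a)\<close> at \<open>v\<close>, the defect
    \<open>Qss + 2 * a * Qst + a^2 * Qtt - (s + t * a)^2\<close> has to be
    \<open>\<kappa> * (a - \<alpha>1) * (a - \<alpha>2)\<close>; comparing coefficients gives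
    \<open>Q\<close> in terms of \<open>s\<close> and \<open>t\<close>. The defect for normals
    \<open>(- 1, c)\<close> at \<open>w\<close> has roots \<open>\<gamma>1\<close>,
    \<open>\<gamma>2\<close> and the same leading coefficient \<open>Qtt - t^2 = \<kappa>\<close>;
    this fixes \<open>t\<close> and \<open>s\<close>.\<close>
  define A where "A = \<alpha>1 + \<alpha>2"
  define B where "B = \<alpha>1 * \<alpha>2"
  define G where "G = \<gamma>1 + \<gamma>2"
  define D where "D = \<gamma>1 * \<gamma>2"
  define t where "t j = \<kappa> j * (A + G) / 2" for j
  define s where "s j = 1/2 + \<kappa> j * (D - B) / 2" for j
  define Qss where "Qss j = (s j)\<^sup>2 + \<kappa> j * B" for j
  define Qst where "Qst j = s j * t j - \<kappa> j * A / 2" for j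
  define Qtt where "Qtt j = (t j)\<^sup>2 + \<kappa> j" for j
  \<comment> \<open>The determinant of \<open>Q\<close> divided by \<open>\<kappa>\<close>. Its
    limit is \<open>1/4\<close>, so \<open>Q\<close> is positive definite once
    \<open>\<kappa>\<close> is small.\<close>
  define h where "h j = (s j)\<^sup>2 + B * (t j)\<^sup>2 + \<kappa> j * B + s j * t j * A - \<kappa> j * A\<^sup>2 / 4" for j
  \<comment> \<open>The Cholesky factor of \<open>Q\<close>, with columns
    \<open>p = (p1, p2)\<close> and \<open>q = (0, q2)\<close>.\<close>
  define p1 where "p1 j = sqrt (Qss j)" for j
  define p2 where "p2 j = Qst j / sqrt (Qss j)" for j
  define q2 where "q2 j = sqrt (\<kappa> j * h j / Qss j)" for j
  have \<kappa>: "\<kappa> \<longlonglongrightarrow> 0" unfolding \<kappa>_def using LIMSEQ_inverse_real_of_nat by (simp add: inverse_eq_divide)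
  have t: "t \<longlonglongrightarrow> 0"
    using tendsto_mult_right[OF \<kappa>, of "(A + G) / 2"] unfolding t_def by (simp add: mult.commute)
  have s: "s \<longlonglongrightarrow> 1/2"
    using tendsto_add[OF tendsto_const[of "1/2"] tendsto_mult_right[OF \<kappa>, of "(D - B) / 2"]]
    unfolding s_def by (simp add: mult.commute)
  have "Qss \<longlonglongrightarrow> (1/2)\<^sup>2 + 0 * B" unfolding Qss_def by (intro tendsto_intros s \<kappa>)
  then have Qss: "Qss \<longlonglongrightarrow> 1/4" by (simp add: power2_eq_square)
  have "Qst \<longlonglongrightarrow> 1/2 * 0 - 0 * A / 2" unfolding Qst_def by (intro tendsto_intros s t \<kappa>) simp
  then have Qst: "Qst \<longlonglongrightarrow> 0" by simp
  have "h \<longlonglongrightarrow> (1/2)\<^sup>2 + B * 0\<^sup>2 + 0 * B + 1/2 * 0 * A - 0 * A\<^sup>2 / 4"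
    unfolding h_def by (intro tendsto_intros s t \<kappa>) simp
  then have h: "h \<longlonglongrightarrow> 1/4" by (simp add: power2_eq_square)
  have root: "sqrt (1/4) = (1/2 :: real)" by (simp add: real_sqrt_divide)
  have p1: "p1 \<longlonglongrightarrow> 1/2" unfolding p1_def root[symmetric] by (intro tendsto_real_sqrt Qss)
  have "p2 \<longlonglongrightarrow> 0 / sqrt (1/4)" unfolding p2_def by (intro tendsto_divide Qst tendsto_real_sqrt Qss) simp
  then have p2: "p2 \<longlonglongrightarrow> 0" by simp
  have "q2 \<longlonglongrightarrow> sqrt (0 * (1/4) / (1/4))"
    unfolding q2_def by (intro tendsto_real_sqrt tendsto_divide tendsto_mult \<kappa> h Qss) simp
  then have q2: "q2 \<longlonglongrightarrow> 0" by simp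
  have "\<forall>\<^sub>F j in sequentially. Qss j > 0 \<and> h j > 0"
    by (intro eventually_conj order_tendstoD(1)[OF Qss] order_tendstoD(1)[OF h]) simp_all
  then obtain N where N: "\<And>j. j \<ge> N \<Longrightarrow> Qss j > 0 \<and> h j > 0" by (auto simp: eventually_sequentially)
  have \<kappa>0: "\<kappa> j > 0" for j by (simp add: \<kappa>_def)
  have det: "Qss j * Qtt j - (Qst j)\<^sup>2 = \<kappa> j * h j" for j
    by (simp add: Qss_def Qst_def Qtt_def h_def algebra_simps power2_eq_square)
  \<comment> \<open>The sign \<open>e\<close> is 1 for the edges at \<open>v\<close> and
    \<open>- 1\<close> for those at \<open>w\<close>, whose normals point the other way along the
    diagonal.\<close>
  have form: "(e * p1 j + p2 j * a)\<^sup>2 + (q2 j * a)\<^sup>2 = Qss j + 2 * e * a * Qst j + a\<^sup>2 * Qtt j"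
    if "j \<ge> N" "e\<^sup>2 = 1" for j a e
  proof -
    have pos: "Qss j > 0" "h j > 0" using N[OF that(1)] by auto
    have "p1 j * p1 j = Qss j" "p1 j * p2 j = Qst j" "p2 j * p2 j = (Qst j)\<^sup>2 / Qss j"
      using pos by (simp_all add: p1_def p2_def power2_eq_square)
    moreover have "q2 j * q2 j = (Qss j * Qtt j - (Qst j)\<^sup>2) / Qss j"
      unfolding det q2_def using pos \<kappa>0[of j] by simp
    moreover have "(e * p1 j + p2 j * a)\<^sup>2 + (q2 j * a)\<^sup>2
        = e\<^sup>2 * (p1 j * p1 j) + 2 * e * a * (p1 j * p2 j) + a\<^sup>2 * (p2 j * p2 j + q2 j * q2 j)"
      by (simp add: algebra_simps power2_eq_square)
    ultimately show ?thesis using pos that(2) by (simp add: add_divide_distrib[symmetric])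
  qed
  have tangent1: "(s j + t j * a)\<^sup>2 = Qss j + 2 * a * Qst j + a\<^sup>2 * Qtt j" if "a \<in> {\<alpha>1, \<alpha>2}" for j a
  proof -
    have "Qss j + 2 * a * Qst j + a\<^sup>2 * Qtt j = (s j + t j * a)\<^sup>2 + \<kappa> j * (a - \<alpha>1) * (a - \<alpha>2)"
      by (simp add: Qss_def Qst_def Qtt_def A_def B_def algebra_simps power2_eq_square)
    then show ?thesis using that by auto
  qed
  have tangent2: "(1 - s j + t j * c)\<^sup>2 = Qss j + 2 * (- 1) * c * Qst j + c\<^sup>2 * Qtt j" if "c \<in> {\<gamma>1, \<gamma>2}" for j c
  proof -
    have "(1 - s j + t j * c)\<^sup>2 = (s j - t j * c)\<^sup>2 + (1 - 2 * s j + 2 * (t j * c))"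
      by (simp add: algebra_simps power2_eq_square)
    also have "1 - 2 * s j + 2 * (t j * c) = \<kappa> j * (c\<^sup>2 + A * c + B) - \<kappa> j * (c - \<gamma>1) * (c - \<gamma>2)"
      by (simp add: s_def t_def G_def D_def field_simps power2_eq_square)
    also have "(s j - t j * c)\<^sup>2 + (\<kappa> j * (c\<^sup>2 + A * c + B) - \<kappa> j * (c - \<gamma>1) * (c - \<gamma>2))
        = Qss j + 2 * (- 1) * c * Qst j + c\<^sup>2 * Qtt j - \<kappa> j * (c - \<gamma>1) * (c - \<gamma>2)"
      by (simp add: Qss_def Qst_def Qtt_def algebra_simps power2_eq_square)
    finally show ?thesis using that by auto
  qed
  note shift = LIMSEQ_ignore_initial_segment[where k = N]
  show ?thesis
  proof (rule that[OF shift[OF s] shift[OF t] shift[OF p1] shift[OF p2] shift[OF q2]])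
    show "\<forall>j. p1 (j + N) > 0" "\<forall>j. q2 (j + N) > 0"
      using N \<kappa>0 by (simp_all add: p1_def q2_def)
    have "(s (j + N) + t (j + N) * a)\<^sup>2 = (p1 (j + N) + p2 (j + N) * a)\<^sup>2 + (q2 (j + N) * a)\<^sup>2"
      if "a \<in> {\<alpha>1, \<alpha>2}" for j a
      using tangent1[OF that, of "j + N"] form[of "j + N" 1 a] by simp
    then show "\<forall>j. \<forall>a\<in>{\<alpha>1, \<alpha>2}. (s (j + N) + t (j + N) * a)\<^sup>2
        = (p1 (j + N) + p2 (j + N) * a)\<^sup>2 + (q2 (j + N) * a)\<^sup>2" by blast
    have "(1 - s (j + N) + t (j + N) * c)\<^sup>2 = (- p1 (j + N) + p2 (j + N) * c)\<^sup>2 + (q2 (j + N) * c)\<^sup>2"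
      if "c \<in> {\<gamma>1, \<gamma>2}" for j c
      using tangent2[OF that, of "j + N"] form[of "j + N" "- 1" c] by simp
    then show "\<forall>j. \<forall>c\<in>{\<gamma>1, \<gamma>2}. (1 - s (j + N) + t (j + N) * c)\<^sup>2
        = (- p1 (j + N) + p2 (j + N) * c)\<^sup>2 + (q2 (j + N) * c)\<^sup>2" by blast
  qed
qed

text \<open>\<open>W\<close> is the second basis vector: it selects the lower diagonal entry
  \<open>c - p\<close>, the end of the diameter that will tend to \<open>v\<close>.\<close>

lemma ellipse_tuple_compression:
  fixes c p q :: "real ^ 'g::finite"
  defines "W \<equiv> mat 2 1 (\<lambda>(i, j). if i = 1 then 1 else 0)"
  shows "W \<in> carrier_mat 2 1" "transpose_mat W * W = 1\<^sub>m 1"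
    "conj_tuple W (ellipse_tuple c p q) = point_tuple (c - p)"
proof -
  show "W \<in> carrier_mat 2 1" by (simp add: W_def)
  show "transpose_mat W * W = 1\<^sub>m 1"
    by (rule eq_matI) (auto simp: W_def scalar_prod_def numeral_2_eq_2)
  have "transpose_mat W * ellipse_tuple c p q k * W = mat 1 1 (\<lambda>_. vec_nth (c - p) k)" for k
    by (rule eq_matI) (auto simp: W_def scalar_prod_def numeral_2_eq_2 ellipse_tuple_def)
  then show "conj_tuple W (ellipse_tuple c p q) = point_tuple (c - p)"
    by (simp add: conj_tuple_def point_tuple_def)
qed

lemma vertex_limit_of_free_extreme_ellipses:
  fixes P :: "(real ^ 2) set"
  assumes "polytope P" "aff_dim P = 2" "card {E. E edge_of P} \<ge> 4" "v extreme_point_of P"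
  obtains c p q :: "nat \<Rightarrow> real ^ 2" where "\<And>j. ellipse_tuple (c j) (p j) (q j) \<in> free_extreme (Wmax P)"
    "(\<lambda>j. c j - p j) \<longlonglongrightarrow> v"
proof -
  obtain w a1 a2 b1 b2 and H :: "((real ^ 2) \<times> real) set" where
    a: "a1 \<noteq> a2" "inner a1 (w - v) = 1" "inner a2 (w - v) = 1"
    and b: "b1 \<noteq> b2" "inner b1 (v - w) = 1" "inner b2 (v - w) = 1"
    and H: "finite H" "\<And>h. h \<in> H \<Longrightarrow> inner (fst h) v < snd h" "\<And>h. h \<in> H \<Longrightarrow> inner (fst h) w < snd h"
    and P: "P = {x. 0 \<le> inner a1 (x - v) \<and> 0 \<le> inner a2 (x - v) \<and> 0 \<le> inner b1 (x - w) \<and> 0 \<le> inner b2 (x - w)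
      \<and> (\<forall>h\<in>H. inner (fst h) x \<le> snd h)}"
    by (rule polygon_two_vertices[OF assms]) (rule that; blast)
  define e where "e = w - v"
  \<comment> \<open>\<open>f\<close> is \<open>e\<close> turned by a right angle. Normals have
    product 1 or \<open>- 1\<close> with \<open>e\<close>, so \<open>\<alpha>\<close> is the only
    coordinate left to record.\<close>
  define f :: "real ^ 2" where "f = (\<chi> i. if i = 1 then - vec_nth e 2 else vec_nth e 1)"
  define \<alpha> where "\<alpha> z = inner z f" for z
  have ae: "inner a1 e = 1" "inner a2 e = 1" using a by (simp_all add: e_def)
  have be: "inner b1 e = - 1" "inner b2 e = - 1" using b by (simp_all add: e_def inner_diff_right)
  obtain s t p1 p2 q2 :: "nat \<Rightarrow> real" where lim: "s \<longlonglongrightarrow> 1/2" "t \<longlonglongrightarrow> 0" "p1 \<longlonglongrightarrow> 1/2" "p2 \<longlonglongrightarrow> 0" "q2 \<longlonglongrightarrow> 0"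
    and pos: "\<forall>j. p1 j > 0" "\<forall>j. q2 j > 0"
    and tan1: "\<forall>j. \<forall>z\<in>{\<alpha> a1, \<alpha> a2}. (s j + t j * z)\<^sup>2 = (p1 j + p2 j * z)\<^sup>2 + (q2 j * z)\<^sup>2"
    and tan2: "\<forall>j. \<forall>z\<in>{\<alpha> b1, \<alpha> b2}. (1 - s j + t j * z)\<^sup>2 = (- p1 j + p2 j * z)\<^sup>2 + (q2 j * z)\<^sup>2"
    by (rule tangent_ellipses_degenerate[of "\<alpha> a1" "\<alpha> a2" "\<alpha> b1" "\<alpha> b2"]) (rule that)
  define c where "c j = v + s j *\<^sub>R e + t j *\<^sub>R f" for j
  define p where "p j = p1 j *\<^sub>R e + p2 j *\<^sub>R f" for j
  define q where "q j = q2 j *\<^sub>R f" for j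
  have "c \<longlonglongrightarrow> v + (1/2) *\<^sub>R e + 0 *\<^sub>R f" unfolding c_def by (intro tendsto_intros lim)
  then have c: "c \<longlonglongrightarrow> v + (1/2) *\<^sub>R e" by simp
  have "p \<longlonglongrightarrow> (1/2) *\<^sub>R e + 0 *\<^sub>R f" unfolding p_def by (intro tendsto_intros lim)
  then have p: "p \<longlonglongrightarrow> (1/2) *\<^sub>R e" by simp
  have "q \<longlonglongrightarrow> 0 *\<^sub>R f" unfolding q_def by (intro tendsto_intros lim)
  then have q: "q \<longlonglongrightarrow> 0" by simp
  \<comment> \<open>Indices 0 and 1 are the edges at \<open>v\<close>, 2 and 3 those at
    \<open>w\<close>; \<open>b\<close> is the offset that makes the affine form vanish on the
    edge.\<close>
  define a where "a i = (if i = 0 then a1 else if i = 1 then a2 else if i = 2 then b1 else b2)" for i :: nat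
  define b where "b i = (if i < 2 then - inner (a i) v else - inner (a i) w)" for i :: nat
  have cases4: "i = 0 \<or> i = 1 \<or> i = 2 \<or> i = 3" if "i < 4" for i :: nat using that by auto
  have edge_v: "b i + inner (a i) (c j) = s j + t j * \<alpha> (a i)" "inner (a i) (p j) = p1 j + p2 j * \<alpha> (a i)"
    "\<alpha> (a i) \<in> {\<alpha> a1, \<alpha> a2}" "inner (a i) e = 1" if "i < 2" for i j
    using that ae by (auto simp: less_2_nat a_def b_def c_def p_def \<alpha>_def inner_add_right)
  have edge_w: "b i + inner (a i) (c j) = 1 - s j + t j * \<alpha> (a i)" "inner (a i) (p j) = - p1 j + p2 j * \<alpha> (a i)"
    "\<alpha> (a i) \<in> {\<alpha> b1, \<alpha> b2}" "inner (a i) e = - 1" if "i < 4" "\<not> i < 2" for i j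
  proof -
    have i: "a i \<in> {b1, b2}" "b i = - inner (a i) w" using that by (auto simp: a_def b_def)
    then show e: "\<alpha> (a i) \<in> {\<alpha> b1, \<alpha> b2}" "inner (a i) e = - 1" using be by auto
    then have "inner (a i) v - inner (a i) w = 1" by (simp add: e_def inner_diff_right)
    with e(2) i(2) show "b i + inner (a i) (c j) = 1 - s j + t j * \<alpha> (a i)"
      "inner (a i) (p j) = - p1 j + p2 j * \<alpha> (a i)"
      by (simp_all add: c_def p_def \<alpha>_def inner_add_right)
  qed
  have aq: "inner (a i) (q j) = q2 j * \<alpha> (a i)" for i j by (simp add: q_def \<alpha>_def)
  have tangent: "(b i + inner (a i) (c j))\<^sup>2 = (inner (a i) (p j))\<^sup>2 + (inner (a i) (q j))\<^sup>2" if "i < 4" for i j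
  proof (cases "i < 2")
    case True
    show ?thesis unfolding edge_v(1,2)[OF True] aq by (rule tan1[rule_format, OF edge_v(3)[OF True]])
  next
    case False
    show ?thesis unfolding edge_w(1,2)[OF that False] aq by (rule tan2[rule_format, OF edge_w(3)[OF that False]])
  qed
  have P': "x \<in> P \<longleftrightarrow> (\<forall>i<4. 0 \<le> b i + inner (a i) x) \<and> (\<forall>h\<in>H. inner (fst h) x \<le> snd h)" for x
  proof -
    have "(\<forall>i<4. 0 \<le> b i + inner (a i) x) \<longleftrightarrow> 0 \<le> inner a1 (x - v) \<and> 0 \<le> inner a2 (x - v)
        \<and> 0 \<le> inner b1 (x - w) \<and> 0 \<le> inner b2 (x - w)"
      by (simp add: numeral_eq_Suc All_less_Suc2 a_def b_def inner_diff_right)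
    then show ?thesis unfolding P by blast
  qed
  have "\<forall>\<^sub>F j in sequentially. \<forall>i\<in>{..<4}. 0 < b i + inner (a i) (c j)"
  proof (intro eventually_ball_finite ballI)
    fix i :: nat assume "i \<in> {..<4}"
    then have i: "i < 4" by simp
    have "(\<lambda>j. b i + inner (a i) (c j)) \<longlonglongrightarrow> b i + inner (a i) (v + (1/2) *\<^sub>R e)" by (intro tendsto_intros c)
    moreover have "b i + inner (a i) (v + (1/2) *\<^sub>R e) = 1/2"
    proof (cases "i < 2")
      case True
      then show ?thesis using edge_v(4)[OF True] by (simp add: b_def inner_add_right)
    next
      case False
      then show ?thesis using edge_w(4)[OF i False] by (simp add: b_def inner_add_right e_def inner_diff_right)
    qed
    ultimately show "\<forall>\<^sub>F j in sequentially. 0 < b i + inner (a i) (c j)" by (auto intro: order_tendstoD(1))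
  qed simp
  \<comment> \<open>The left side bounds the form over the whole ellipse. Its limit is the larger of
    the values at \<open>v\<close> and \<open>w\<close>, which is below
    \<open>snd h\<close>.\<close>
  moreover have "\<forall>\<^sub>F j in sequentially. \<forall>h\<in>H. inner (fst h) (c j) + \<bar>inner (fst h) (p j)\<bar> + \<bar>inner (fst h) (q j)\<bar> < snd h"
  proof (intro eventually_ball_finite H(1) ballI)
    fix h assume h: "h \<in> H"
    have "(\<lambda>j. inner (fst h) (c j) + \<bar>inner (fst h) (p j)\<bar> + \<bar>inner (fst h) (q j)\<bar>)
        \<longlonglongrightarrow> inner (fst h) (v + (1/2) *\<^sub>R e) + \<bar>inner (fst h) ((1/2) *\<^sub>R e)\<bar> + \<bar>inner (fst h) 0\<bar>"
      by (intro tendsto_intros c p q)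
    moreover have "inner (fst h) (v + (1/2) *\<^sub>R e) + \<bar>inner (fst h) ((1/2) *\<^sub>R e)\<bar> + \<bar>inner (fst h) 0\<bar> < snd h"
      using H(2,3)[OF h] by (simp add: e_def inner_add_right inner_diff_right abs_if field_simps)
    ultimately show "\<forall>\<^sub>F j in sequentially. inner (fst h) (c j) + \<bar>inner (fst h) (p j)\<bar> + \<bar>inner (fst h) (q j)\<bar> < snd h"
      by (rule order_tendstoD(2))
  qed
  ultimately have "\<forall>\<^sub>F j in sequentially. (\<forall>i\<in>{..<4}. 0 < b i + inner (a i) (c j)) \<and>
      (\<forall>h\<in>H. inner (fst h) (c j) + \<bar>inner (fst h) (p j)\<bar> + \<bar>inner (fst h) (q j)\<bar> < snd h)"
    by (rule eventually_conj)
  then obtain N where N: "\<And>i j. j \<ge> N \<Longrightarrow> i < 4 \<Longrightarrow> 0 < b i + inner (a i) (c j)"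
    "\<And>h j. j \<ge> N \<Longrightarrow> h \<in> H \<Longrightarrow> inner (fst h) (c j) + \<bar>inner (fst h) (p j)\<bar> + \<bar>inner (fst h) (q j)\<bar> < snd h"
    unfolding eventually_sequentially by (metis lessThan_iff)
  have "ellipse_tuple (c j) (p j) (q j) \<in> free_extreme (Wmax P)" if j: "j \<ge> N" for j
  proof (rule ellipse_tuple_free_extreme)
    fix \<xi> \<eta> :: real assume unit: "\<xi>\<^sup>2 + \<eta>\<^sup>2 = 1"
    have "0 \<le> b i + inner (a i) (c j + \<xi> *\<^sub>R p j + \<eta> *\<^sub>R q j)" if i: "i < 4" for i
    proof -
      define \<beta> \<gamma> where "\<beta> = inner (a i) (p j)" and "\<gamma> = inner (a i) (q j)"
      \<comment> \<open>Lagrange's identity, for Cauchy-Schwarz: on the ellipse the form deviates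
        from its value at the centre by at most the root of \<open>\<beta>^2 + \<gamma>^2\<close>,
        which by tangency equals that value.\<close>
      have "(\<beta>\<^sup>2 + \<gamma>\<^sup>2) * (\<xi>\<^sup>2 + \<eta>\<^sup>2) - (\<xi> * \<beta> + \<eta> * \<gamma>)\<^sup>2 = (\<xi> * \<gamma> - \<eta> * \<beta>)\<^sup>2"
        by (simp add: algebra_simps power2_eq_square)
      then have "(\<xi> * \<beta> + \<eta> * \<gamma>)\<^sup>2 \<le> \<beta>\<^sup>2 + \<gamma>\<^sup>2"
        unfolding unit by (metis diff_ge_0_iff_ge mult.right_neutral zero_le_power2)
      then have "(\<xi> * \<beta> + \<eta> * \<gamma>)\<^sup>2 \<le> (b i + inner (a i) (c j))\<^sup>2"
        using tangent[OF i, of j] by (simp add: \<beta>_def \<gamma>_def)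
      then have "\<bar>\<xi> * \<beta> + \<eta> * \<gamma>\<bar> \<le> b i + inner (a i) (c j)"
        using N(1)[OF j i] by (metis abs_le_square_iff abs_of_pos)
      then show ?thesis by (simp add: inner_add_right \<beta>_def \<gamma>_def)
    qed
    moreover have "inner (fst h) (c j + \<xi> *\<^sub>R p j + \<eta> *\<^sub>R q j) \<le> snd h" if h: "h \<in> H" for h
    proof -
      have "\<xi>\<^sup>2 \<le> 1" "\<eta>\<^sup>2 \<le> 1" using unit zero_le_power2[of \<xi>] zero_le_power2[of \<eta>] by linarith+
      then have "\<bar>\<xi>\<bar> \<le> 1" "\<bar>\<eta>\<bar> \<le> 1" by (simp_all add: abs_square_le_1)
      then have "\<bar>\<xi> * inner (fst h) (p j)\<bar> \<le> \<bar>inner (fst h) (p j)\<bar>" "\<bar>\<eta> * inner (fst h) (q j)\<bar> \<le> \<bar>inner (fst h) (q j)\<bar>"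
        by (simp_all add: abs_mult mult_left_le_one_le)
      then show ?thesis using N(2)[OF j h] by (simp add: inner_add_right)
    qed
    ultimately show "c j + \<xi> *\<^sub>R p j + \<eta> *\<^sub>R q j \<in> P" unfolding P' by blast
  next
    have "vec_nth (p j) 1 * vec_nth (q j) 2 - vec_nth (p j) 2 * vec_nth (q j) 1 = p1 j * q2 j * inner e e"
      by (simp add: p_def q_def f_def inner_plane algebra_simps)
    moreover have "e \<noteq> 0" using ae by auto
    ultimately show "vec_nth (p j) 1 * vec_nth (q j) 2 \<noteq> vec_nth (p j) 2 * vec_nth (q j) 1"
      using pos by (metis eq_iff_diff_eq_0 inner_eq_zero_iff less_irrefl mult_eq_0_iff)
  next
    show "0 \<le> b i + inner (a i) x" if "i < 4" "x \<in> P" for i x using that P' by blast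
    show "0 < b i + inner (a i) (c j)" if "i < 4" for i using N(1)[OF j that] .
    show "(b i + inner (a i) (c j))\<^sup>2 = (inner (a i) (p j))\<^sup>2 + (inner (a i) (q j))\<^sup>2" if "i < 4" for i
      using tangent[OF that] .
    show "(b k + inner (a k) (c j)) *\<^sub>R a i \<noteq> (b i + inner (a i) (c j)) *\<^sub>R a k" if ik: "i < 4" "k < 4" "i \<noteq> k" for i k
    proof
      assume eq: "(b k + inner (a k) (c j)) *\<^sub>R a i = (b i + inner (a i) (c j)) *\<^sub>R a k"
      \<comment> \<open>Pairing with \<open>e\<close> compares signs: the values at the centre are
        positive, so both edges lie at the same vertex, and then their normalised normals
        coincide.\<close>
      from arg_cong[OF eq, of "\<lambda>z. inner z e"]
      have "(b k + inner (a k) (c j)) * inner (a i) e = (b i + inner (a i) (c j)) * inner (a k) e" by simp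
      moreover have "inner (a i) e = (if i < 2 then 1 else - 1)" "inner (a k) e = (if k < 2 then 1 else - 1)"
        using edge_v(4) edge_w(4) ik by auto
      ultimately have same: "(i < 2) = (k < 2)" "b k + inner (a k) (c j) = b i + inner (a i) (c j)"
        using N(1)[OF j ik(1)] N(1)[OF j ik(2)] by (auto split: if_splits)
      then have "a i = a k" using eq N(1)[OF j ik(1)] by simp
      with same(1) ik \<open>a1 \<noteq> a2\<close> \<open>b1 \<noteq> b2\<close> show False
        using cases4[OF ik(1)] cases4[OF ik(2)] by (auto simp: a_def split: if_splits)
    qed
  qed
  moreover have "(\<lambda>j. c j - p j) \<longlonglongrightarrow> v" using tendsto_diff[OF c p] by simp
  ultimately show ?thesis
    by (intro that[of "\<lambda>j. c (j + N)" "\<lambda>j. p (j + N)" "\<lambda>j. q (j + N)"])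
      (auto intro: LIMSEQ_ignore_initial_segment)
qed

theorem corollary3p4:
  fixes P :: "(real ^ 2) set" and d :: nat
  assumes "polytope P" and "aff_dim P = 2"
    and "card {F. F edge_of P} = d" and "d \<ge> 4"
  shows "\<forall>v. v extreme_point_of P \<longrightarrow> point_tuple v \<notin> crucial_free_extreme (Wmax P)"
proof (intro allI impI)
  fix v assume v: "v extreme_point_of P"
  let ?K = "free_extreme (Wmax P) - {Y \<in> Wmax P. unitarily_equiv Y (point_tuple v)}"
  have "card {E. E edge_of P} \<ge> 4" using assms(3,4) by simp
  from vertex_limit_of_free_extreme_ellipses[OF assms(1,2) this v]
  obtain c p q :: "nat \<Rightarrow> real ^ 2" where E: "\<And>j. ellipse_tuple (c j) (p j) (q j) \<in> free_extreme (Wmax P)"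
    and lim: "(\<lambda>j. c j - p j) \<longlonglongrightarrow> v" by blast
  have point_SM: "point_tuple z \<in> SM 1" for z :: "real ^ 2"
    by (auto simp: SM_def point_tuple_def intro!: eq_matI)
  \<comment> \<open>Unitary equivalence preserves size, so removing the equivalents of the vertex
    leaves the ellipse pairs of size 2 available.\<close>
  have "\<not> unitarily_equiv (ellipse_tuple (c j) (p j) (q j)) (point_tuple v)" for j
  proof
    assume "unitarily_equiv (ellipse_tuple (c j) (p j) (q j)) (point_tuple v)"
    then obtain n where "ellipse_tuple (c j) (p j) (q j) 1 \<in> carrier_mat n n" "point_tuple v 1 \<in> carrier_mat n n"
      unfolding unitarily_equiv_def by blast
    then have "n = 2" "n = 1"
      using carrier_matD(1)[OF SM_carrier[OF ellipse_tuple_SM, of "c j" "p j" "q j" 1]]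
        carrier_matD(1)[OF SM_carrier[OF point_SM, of v 1]] carrier_matD(1) by force+
    then show False by simp
  qed
  then have K: "ellipse_tuple (c j) (p j) (q j) \<in> ?K" for j using E by blast
  have "point_tuple (c j - p j) \<in> co_mat ?K" for j
    unfolding co_mat_def mem_Collect_eq
    by (rule exI[of _ 1], rule conjI[OF order_refl], (rule exI)+,
        rule matrix_convex_comb_compression[OF K ellipse_tuple_SM ellipse_tuple_compression(1,2),
          unfolded ellipse_tuple_compression(3)])
  then have level: "point_tuple (c j - p j) \<in> level (co_mat ?K) 1" for j
    using point_SM unfolding level_def by (rule IntI)
  have conv: "(\<lambda>j. point_tuple (c j - p j) k $$ (r, l)) \<longlonglongrightarrow> point_tuple v k $$ (r, l)"
    if "r < 1" "l < 1" for k r l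
    using that tendsto_vec_nth[OF lim, of k] by (simp add: point_tuple_def)
  have "point_tuple v \<in> level_closure (co_mat ?K)"
    unfolding level_closure_def mem_Collect_eq
    by (rule exI[of _ 1], intro conjI order_refl point_SM exI[of _ "\<lambda>j. point_tuple (c j - p j)"] allI impI level conv)
  then show "point_tuple v \<notin> crucial_free_extreme (Wmax P)"
    unfolding crucial_free_extreme_def by blast
qed

end
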